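(* Let $\vartheta$ be a compatible, unimodular, irreducible Pisot random substitution. Then the Rauzy fractal $\mathcal R_\vartheta\subset\mathbb H$ is the closure of its interior (with respect to the topology of $\mathbb H$).
   Context: Let $\mathcal A=\{1,\dots,d\}$, $\mathcal A^+$ the set of non-empty finite words, $|u|_i$ the number of occurrences of $i$ in $u$, $\psi(u)=(|u|_1,\dots,|u|_d)^T$, and $x_{[1,n]}=x_1\cdots x_n$ (empty if $n=0$). $S$ is the left shift on $\mathcal A^{\mathbb N}$ (product topology); the shift-orbit of $x$ is $\{S^n x:n\ge 0\}$. Random substitution (set-valued part): a map $\vartheta$ assigning to each letter a non-empty finite subset of $\mathcal A^+$ (the probabilities attached to realisations play no role here). For $u=u_1\cdots u_n$ put $\vartheta(u)=\{v_1\cdots v_n: v_i\in\vartheta(u_i)\}$, and similarly for infinite sequences; $\vartheta(X)=\bigcup_{x\in X}\vartheta(x)$; $\vartheta^0(u)=\{u\}$ and $\vartheta^{n+1}(u)=\bigcup_{v\in\vartheta^n(u)}\vartheta(v)$. It is compatible if $\psi(u)=\psi(v)$ for all $a\in\mathcal A$ and $u,v\in\vartheta(a)$; then the substitution matrix is $M_{i,j}=|v|_i$ for any $v\in\vartheta(j)$. It is primitive if $M$ is primitive with Perron–Frobenius eigenvalue $\lambda>1$. A compatible primitive $\vartheta$ is irreducible Pisot if $\lambda$ is a Pisot number and the characteristic polynomial of $M$ is irreducible over $\mathbb Z$; it is unimodular if $|\det M|=1$. A word is legal if it is a subword of some element of $\vartheta^k(a)$, $a\in\mathcal A$, $k\in\mathbb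 N$. $X_\vartheta$ is the set of $x\in\mathcal A^{\mathbb N}$ all of whose finite subwords are legal, and $X_\vartheta^\infty=\bigcap_{n\ge0}\vartheta^n(X_\vartheta)$. Let $\mathbf L,\mathbf R$ be left and right Perron–Frobenius eigenvectors of $M$; $\mathbb H\subset\mathbb R^d$ is the hyperplane orthogonal to $\mathbf L$; $\pi$ is the linear projection along $\mathbf R$ onto $\mathbb H$. For $w\in X_\vartheta$ let $\mathcal S_a(w)=\{\psi(w_{[1,n]}):n\ge0,\ w_{n+1}=a\}$ and $\mathcal R_a(w)=\overline{\pi(\mathcal S_a(w))}$. The Rauzy fractal of $\vartheta$ is $\mathcal R_\vartheta=\bigcup_{a\in\mathcal A}\mathcal R_{\vartheta,a}$, where $\mathcal R_{\vartheta,a}=\mathcal R_a(w)$ for any $w\in X_\vartheta^\infty$ with dense shift-orbit in $X_\vartheta$ (such $w$ exist, and the sets do not depend on the choice of $w$). *)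

theory Defs
  imports "HOL-Analysis.Analysis" "HOL-Computational_Algebra.Polynomial_Factorial" "HOL-Library.Sublist"
begin

text \<open>
  The alphabet is a finite type \<open>'a\<close> (so d is \<open>CARD('a)\<close>), finite words are lists, and
  one-sided sequences are functions \<open>nat \<Rightarrow> 'a\<close> indexed from 0: the letter \<open>x\<^sub>n\<^sub>+\<^sub>1\<close> is \<open>x n\<close>.
\<close>

definition abelianisation :: "'a list \<Rightarrow> real ^ 'a::finite" where
  "abelianisation u = (\<chi> i. real (count_list u i))"

definition factor :: "(nat \<Rightarrow> 'a) \<Rightarrow> nat \<Rightarrow> nat \<Rightarrow> 'a list" where
  "factor x i j = map x [i..<j]"

definition shift_orbit :: "(nat \<Rightarrow> 'a) \<Rightarrow> (nat \<Rightarrow> 'a) set" where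
  "shift_orbit x = range (\<lambda>n k. x (n + k))"

definition seq_topology :: "(nat \<Rightarrow> 'a) topology" where
  "seq_topology = product_topology (\<lambda>_. discrete_topology UNIV) UNIV"


section \<open>Random substitutions\<close>

definition random_substitution :: "('a \<Rightarrow> 'a list set) \<Rightarrow> bool" where
  "random_substitution \<theta> \<longleftrightarrow> (\<forall>a. finite (\<theta> a) \<and> \<theta> a \<noteq> {} \<and> [] \<notin> \<theta> a)"

definition subst_word :: "('a \<Rightarrow> 'a list set) \<Rightarrow> 'a list \<Rightarrow> 'a list set" where
  "subst_word \<theta> u = {concat vs | vs. list_all2 (\<lambda>v a. v \<in> \<theta> a) vs u}"

text \<open>
  A sequence \<open>y\<close> is the infinite concatenation of the words \<open>v 0, v 1, \<dots>\<close> iff every finite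
  concatenation is a prefix of it; as the realisations are non-empty, \<open>v\<close> determines \<open>y\<close>.
\<close>
definition subst_seq :: "('a \<Rightarrow> 'a list set) \<Rightarrow> (nat \<Rightarrow> 'a) \<Rightarrow> (nat \<Rightarrow> 'a) set" where
  "subst_seq \<theta> x = {y. \<exists>v. (\<forall>i. v i \<in> \<theta> (x i)) \<and>
     (\<forall>n. let u = concat (map v [0..<n]) in factor y 0 (length u) = u)}"

definition subst_word_iter :: "('a \<Rightarrow> 'a list set) \<Rightarrow> nat \<Rightarrow> 'a list \<Rightarrow> 'a list set" where
  "subst_word_iter \<theta> n u = ((\<lambda>U. \<Union>v\<in>U. subst_word \<theta> v) ^^ n) {u}"

definition subst_seq_iter ::
  "('a \<Rightarrow> 'a list set) \<Rightarrow> nat \<Rightarrow> (nat \<Rightarrow> 'a) set \<Rightarrow> (nat \<Rightarrow> 'a) set" where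
  "subst_seq_iter \<theta> n X = ((\<lambda>Y. \<Union>x\<in>Y. subst_seq \<theta> x) ^^ n) X"

definition legal :: "('a \<Rightarrow> 'a list set) \<Rightarrow> 'a list \<Rightarrow> bool" where
  "legal \<theta> u \<longleftrightarrow> (\<exists>a k. \<exists>v\<in>subst_word_iter \<theta> k [a]. sublist u v)"

definition subst_space :: "('a \<Rightarrow> 'a list set) \<Rightarrow> (nat \<Rightarrow> 'a) set" where
  "subst_space \<theta> = {x. \<forall>i j. legal \<theta> (factor x i j)}"

definition subst_space_infinity :: "('a \<Rightarrow> 'a list set) \<Rightarrow> (nat \<Rightarrow> 'a) set" where
  "subst_space_infinity \<theta> = (\<Inter>n. subst_seq_iter \<theta> n (subst_space \<theta>))"

definition has_dense_orbit :: "('a \<Rightarrow> 'a list set) \<Rightarrow> (nat \<Rightarrow> 'a) \<Rightarrow> bool" where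
  "has_dense_orbit \<theta> w \<longleftrightarrow>
     subtopology seq_topology (subst_space \<theta>) closure_of shift_orbit w = subst_space \<theta>"


section \<open>Matrices\<close>

definition charpoly :: "'b::comm_ring_1 ^ 'a ^ 'a::finite \<Rightarrow> 'b poly" where
  "charpoly A = det (mat [:0, 1:] - map_matrix (\<lambda>c. [:c:]) A)"

definition eigenvalue :: "'b::field ^ 'a ^ 'a::finite \<Rightarrow> 'b \<Rightarrow> bool" where
  "eigenvalue A c \<longleftrightarrow> (\<exists>v. v \<noteq> 0 \<and> A *v v = c *s v)"

definition primitive_matrix :: "real ^ 'a ^ 'a::finite \<Rightarrow> bool" where
  "primitive_matrix A \<longleftrightarrow> (\<forall>i j. A $ i $ j \<ge> 0) \<and>
     (\<exists>k>0. \<forall>i j. (((**) A) ^^ k) (mat 1) $ i $ j > 0)"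

text \<open>
  The dominant eigenvalue provided by the Perron-Frobenius theorem for primitive matrices; it is
  unique, so that it can be given as a predicate.
\<close>
definition pf_eigenvalue :: "real ^ 'a ^ 'a::finite \<Rightarrow> real \<Rightarrow> bool" where
  "pf_eigenvalue A lam \<longleftrightarrow> lam > 0 \<and> eigenvalue A lam \<and>
     (\<forall>\<mu>. eigenvalue (map_matrix complex_of_real A) \<mu> \<and> \<mu> \<noteq> complex_of_real lam \<longrightarrow> cmod \<mu> < lam)"

definition right_pf_eigenvector :: "real ^ 'a ^ 'a::finite \<Rightarrow> real ^ 'a \<Rightarrow> bool" where
  "right_pf_eigenvector A r \<longleftrightarrow>
     (\<forall>i. r $ i > 0) \<and> (\<exists>lam. pf_eigenvalue A lam \<and> A *v r = lam *s r)"

definition left_pf_eigenvector :: "real ^ 'a ^ 'a::finite \<Rightarrow> real ^ 'a \<Rightarrow> bool" where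
  "left_pf_eigenvector A l \<longleftrightarrow>
     (\<forall>i. l $ i > 0) \<and> (\<exists>lam. pf_eigenvalue A lam \<and> l v* A = lam *s l)"

text \<open>
  The monic irreducible \<open>p\<close> is the minimal polynomial of \<open>lam\<close>, so its other complex roots are
  the other Galois conjugates of \<open>lam\<close>.
\<close>
definition pisot_number :: "real \<Rightarrow> bool" where
  "pisot_number lam \<longleftrightarrow> lam > 1 \<and>
     (\<exists>p :: int poly. lead_coeff p = 1 \<and> irreducible p \<and> poly (map_poly of_int p) lam = 0 \<and>
        (\<forall>z::complex. poly (map_poly of_int p) z = 0 \<and> z \<noteq> of_real lam \<longrightarrow> cmod z < 1))"


section \<open>Classes of random substitutions\<close>

definition compatible :: "('a::finite \<Rightarrow> 'a list set) \<Rightarrow> bool" where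
  "compatible \<theta> \<longleftrightarrow> (\<forall>a. \<forall>u\<in>\<theta> a. \<forall>v\<in>\<theta> a. abelianisation u = abelianisation v)"

text \<open>Only meaningful for compatible \<open>\<theta>\<close>, where the chosen realisation is irrelevant.\<close>
definition subst_matrix :: "('a \<Rightarrow> 'a list set) \<Rightarrow> int ^ 'a ^ 'a::finite" where
  "subst_matrix \<theta> = (\<chi> i j. int (count_list (SOME v. v \<in> \<theta> j) i))"

definition real_subst_matrix :: "('a \<Rightarrow> 'a list set) \<Rightarrow> real ^ 'a ^ 'a::finite" where
  "real_subst_matrix \<theta> = map_matrix real_of_int (subst_matrix \<theta>)"

definition primitive_subst :: "('a::finite \<Rightarrow> 'a list set) \<Rightarrow> bool" where
  "primitive_subst \<theta> \<longleftrightarrow> primitive_matrix (real_subst_matrix \<theta>) \<and>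
     (\<exists>lam>1. pf_eigenvalue (real_subst_matrix \<theta>) lam)"

definition irreducible_pisot :: "('a::finite \<Rightarrow> 'a list set) \<Rightarrow> bool" where
  "irreducible_pisot \<theta> \<longleftrightarrow> compatible \<theta> \<and> primitive_subst \<theta> \<and>
     (\<exists>lam. pf_eigenvalue (real_subst_matrix \<theta>) lam \<and> pisot_number lam) \<and>
     irreducible (charpoly (subst_matrix \<theta>))"

definition unimodular :: "('a::finite \<Rightarrow> 'a list set) \<Rightarrow> bool" where
  "unimodular \<theta> \<longleftrightarrow> \<bar>det (subst_matrix \<theta>)\<bar> = 1"


section \<open>Rauzy fractals\<close>

definition hyperplane :: "real ^ 'a::finite \<Rightarrow> (real ^ 'a) set" where
  "hyperplane l = {x. l \<bullet> x = 0}"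

text \<open>The linear map with kernel spanned by \<open>r\<close> that fixes \<open>hyperplane l\<close> pointwise (for \<open>l \<bullet> r \<noteq> 0\<close>).\<close>
definition proj_along :: "real ^ 'a::finite \<Rightarrow> real ^ 'a \<Rightarrow> real ^ 'a \<Rightarrow> real ^ 'a" where
  "proj_along l r x = x - ((l \<bullet> x) / (l \<bullet> r)) *\<^sub>R r"

definition prefix_vectors :: "(nat \<Rightarrow> 'a) \<Rightarrow> 'a \<Rightarrow> (real ^ 'a::finite) set" where
  "prefix_vectors w a = {abelianisation (factor w 0 n) | n. w n = a}"

definition rauzy_subtile ::
  "real ^ 'a::finite \<Rightarrow> real ^ 'a \<Rightarrow> (nat \<Rightarrow> 'a) \<Rightarrow> 'a \<Rightarrow> (real ^ 'a) set" where
  "rauzy_subtile l r w a = closure (proj_along l r ` prefix_vectors w a)"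

text \<open>
  A set \<open>F\<close> is the Rauzy fractal of \<open>\<theta>\<close> if it is computed from some admissible sequence \<open>w\<close>.
  Mathematically \<open>F\<close> is unique, and independent of \<open>w\<close>; the relational form does not presuppose
  this, so a theorem about every such \<open>F\<close> covers all choices of \<open>w\<close>.
\<close>
definition is_rauzy_fractal ::
  "('a \<Rightarrow> 'a list set) \<Rightarrow> real ^ 'a \<Rightarrow> real ^ 'a \<Rightarrow> (real ^ 'a::finite) set \<Rightarrow> bool" where
  "is_rauzy_fractal \<theta> l r F \<longleftrightarrow>
     (\<exists>w\<in>subst_space_infinity \<theta>. has_dense_orbit \<theta> w \<and> F = (\<Union>a. rauzy_subtile l r w a))"

end

theory Submission
  imports Defs "HOL-Computational_Algebra.Fundamental_Theorem_Algebra"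
begin

text \<open>
  Write \<open>A\<close> for the substitution matrix, \<open>\<psi>\<close> for abelianisation, \<open>\<pi>\<close> for the projection along \<open>r\<close>
  onto the hyperplane \<open>H\<close> orthogonal to \<open>l\<close>, \<open>S\<^sub>b\<close> for the projected prefix vectors of \<open>w\<close> that are
  followed by the letter \<open>b\<close>, and \<open>R\<^sub>b\<close> for the closure of \<open>S\<^sub>b\<close>; the Rauzy fractal is the union of
  the subtiles \<open>R\<^sub>b\<close>. It is the closure of its interior because it can be cut, at arbitrarily small
  scales, into affine images of subtiles, each of which has interior points.

  \<^item> Contraction. The eigenvalues of \<open>A\<close> on \<open>H\<close> are the Galois conjugates of the Pisot number
  \<open>\<lambda>\<close> other than \<open>\<lambda>\<close> itself, so \<open>A\<^sup>n\<close> is \<open>O(\<rho>\<^sup>n)\<close> on \<open>H\<close> for some \<open>\<rho> < 1\<close> (\<open>hyperplane_decay\<close>).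
  Cutting words into images of letters turns this into \<open>A\<^sup>n \<pi>\<psi>(u) = O(\<rho>\<^sup>n)\<close>, uniformly over all legal
  words \<open>u\<close> (\<open>legal_contraction\<close>).

  \<^item> Self-similarity. Let \<open>T\<^sub>n\<^sub>,\<^sub>b\<close> be the finite set of all \<open>\<pi>\<psi>(p)\<close> for which \<open>p b\<close> is a
  prefix of an element of \<open>\<theta>\<^sup>n(c)\<close> for some letter \<open>c\<close>. Since \<open>w\<close> has \<open>n\<close>-th preimages, \<open>S\<^sub>b\<close> lies within
  \<open>O(\<rho>\<^sup>n)\<close> of \<open>T\<^sub>n\<^sub>,\<^sub>b\<close>. Conversely, some legal word contains all elements of all \<open>\<theta>\<^sup>n(c)\<close>
  as aligned blocks, and it occurs in \<open>w\<close>; so a translate \<open>T\<^sub>n\<^sub>,\<^sub>b + \<delta>\<close>, with the same \<open>\<delta>\<close> for all \<open>b\<close>, lies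
  within \<open>O(\<rho>\<^sup>n)\<close> of \<open>S\<^sub>b\<close>. Hence translation by \<open>\<delta>\<close> moves \<open>S\<^sub>b\<close> into an \<open>O(\<rho>\<^sup>n)\<close>-neighbourhood of
  itself, and as \<open>S\<^sub>b\<close> is bounded, iterating the translation shows that \<open>\<delta>\<close> is itself \<open>O(\<rho>\<^sup>n)\<close>
  (\<open>approximant_near_S\<close>). The sets \<open>T\<^sub>n\<^sub>,\<^sub>b\<close> refer to \<open>\<theta>\<close> only, and substituting into the words that define
  them yields \<open>A\<^sup>n R\<^sub>e + \<pi>\<psi>(p) \<subseteq> R\<^sub>b\<close> whenever \<open>p b\<close> is a prefix of an element of \<open>\<theta>\<^sup>n(e)\<close>
  (\<open>subtile_inclusion\<close>).

  \<^item> Interior. An integer vector orthogonal to \<open>r\<close> has an orbit under the transpose of \<open>A\<close> that tends to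
  \<open>0\<close> through integer vectors; as \<open>A\<close> is invertible, the vector is \<open>0\<close>. So \<open>r\<close> has rationally independent
  coordinates, and by Kronecker's theorem the integer vectors with nonnegative coordinate sum project to
  a dense subset of \<open>H\<close>. Each of them is a prefix vector of \<open>w\<close> plus an integer vector with
  coordinate sum \<open>0\<close>, so the translates of the subtiles by the projections of the latter cover \<open>H\<close>
  (\<open>translates_cover\<close>). By the Baire category theorem some subtile has interior points, and by
  self-similarity and primitivity all of them have.

  \<^item> Conclusion. A point of \<open>S\<^sub>b\<close> is within \<open>O(\<rho>\<^sup>n)\<close> of some \<open>\<pi>\<psi>(p)\<close> in \<open>T\<^sub>n\<^sub>,\<^sub>b\<close>, and the piece
  \<open>A\<^sup>n R\<^sub>c + \<pi>\<psi>(p)\<close> of \<open>R\<^sub>b\<close> has interior points, all within \<open>O(\<rho>\<^sup>n)\<close> of \<open>\<pi>\<psi>(p)\<close>.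
\<close>


section \<open>Eigenvalues as roots of the characteristic polynomial\<close>

lemma poly_of_int_mult:
  "poly (map_poly of_int (p * q)) (x::'b::comm_ring_1) =
   poly (map_poly of_int p) x * poly (map_poly of_int q) x"
proof -
  have "map_poly of_int (p * q) = (map_poly of_int p * map_poly of_int q :: 'b poly)"
    by (rule poly_eqI) (simp add: coeff_map_poly coeff_mult)
  then show ?thesis by simp
qed

lemma poly_of_int_add:
  "poly (map_poly of_int (p + q)) (x::'b::comm_ring_1) =
   poly (map_poly of_int p) x + poly (map_poly of_int q) x"
proof -
  have "map_poly of_int (p + q) = (map_poly of_int p + map_poly of_int q :: 'b poly)"
    by (rule poly_eqI) (simp add: coeff_map_poly)
  then show ?thesis by simp
qed

text \<open>
  Let \<open>m\<close> have least degree among the nonzero integer polynomials that vanish at \<open>x\<close>. Pseudo-division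
  by \<open>m\<close> shows that \<open>m\<close> divides a nonzero integer multiple of every integer polynomial that vanishes at
  \<open>x\<close>. Applied to \<open>p\<close>, which is prime, this gives \<open>p dvd m\<close>; applied to \<open>q\<close>, it then gives the claim.
\<close>

lemma irreducible_int_poly_dvd_of_common_root:
  fixes p q :: "int poly" and x :: "'b::{comm_ring_1,ring_char_0,idom}"
  assumes "irreducible p" "poly (map_poly of_int p) x = 0"
    and "poly (map_poly of_int q) x = 0"
  shows "p dvd q"
proof -
  let ?R = "\<lambda>f::int poly. poly (map_poly of_int f) x = 0"
  define n where "n = (LEAST n. \<exists>f. f \<noteq> 0 \<and> ?R f \<and> degree f = n)"
  have "p \<noteq> 0"
    using assms(1) by auto
  then have "\<exists>f. f \<noteq> 0 \<and> ?R f \<and> degree f = n"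
    unfolding n_def using assms(2) by (intro LeastI_ex[where P="\<lambda>n. \<exists>f. f \<noteq> 0 \<and> ?R f \<and> degree f = n"]) blast
  then obtain m where m: "m \<noteq> 0" "?R m" "degree m = n"
    by blast
  have minimal: "n \<le> degree f" if "f \<noteq> 0" "?R f" for f
    unfolding n_def using that by (intro Least_le) auto
  have "degree m \<noteq> 0"
  proof
    assume "degree m = 0"
    then obtain a where "m = [:a:]"
      by (metis degree_eq_zeroE)
    then show False
      using m by (simp add: map_poly_pCons)
  qed
  have divides: "\<exists>a. a \<noteq> 0 \<and> m dvd smult a f" if f: "?R f" for f
  proof -
    obtain a g where ag: "a \<noteq> 0" "smult a f = m * g + pseudo_mod f m"
      and deg: "pseudo_mod f m = 0 \<or> degree (pseudo_mod f m) < degree m"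
      using pseudo_mod[OF \<open>m \<noteq> 0\<close>, of f] by blast
    have "?R (smult a f)"
      using f poly_of_int_mult[of "[:a:]" f x] by simp
    then have "?R (pseudo_mod f m)"
      unfolding ag(2) by (simp add: poly_of_int_add poly_of_int_mult m)
    then have "pseudo_mod f m = 0"
      using deg minimal[of "pseudo_mod f m"] m by (meson leD)
    then show ?thesis
      using ag by auto
  qed
  have prime: "prime_elem p"
    using assms(1) by (rule irreducible_imp_prime_elem)
  have not_dvd_const: "\<not> p dvd [:a:]" if "a \<noteq> 0" for a
  proof
    assume "p dvd [:a:]"
    then have "degree p = 0"
      using that by (metis degree_pCons_0 dvd_imp_degree_le le_zero_eq pCons_eq_0_iff)
    then obtain b where "p = [:b:]"
      by (metis degree_eq_zeroE)
    then show False
      using \<open>p \<noteq> 0\<close> assms(2) by (simp add: map_poly_pCons)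
  qed
  obtain a g where ag: "a \<noteq> 0" "smult a p = m * g"
    using divides[OF assms(2)] unfolding dvd_def by blast
  have "p dvd m"
  proof (rule ccontr)
    assume "\<not> p dvd m"
    moreover have "p dvd m * g"
      unfolding ag(2)[symmetric] by (simp add: dvd_smult)
    ultimately have "p dvd g"
      using prime by (simp add: prime_elem_dvd_mult_iff)
    then obtain h where "g = p * h" by auto
    then have "p * [:a:] = p * (m * h)"
      using ag(2) by (simp add: algebra_simps)
    then have "[:a:] = m * h"
      using \<open>p \<noteq> 0\<close> mult_left_cancel by blast
    then have "m dvd [:a:]"
      by simp
    then have "degree m = 0"
      using ag(1) by (metis degree_pCons_0 dvd_imp_degree_le le_zero_eq pCons_eq_0_iff)
    then show False
      using \<open>degree m \<noteq> 0\<close> by simp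
  qed
  moreover obtain b where b: "b \<noteq> 0" "m dvd smult b q"
    using divides[OF assms(3)] by auto
  ultimately have "p dvd [:b:] * q"
    using dvd_trans by simp
  then show ?thesis
    using prime_elem_dvd_multD[OF prime] not_dvd_const[OF b(1)] by blast
qed

text \<open>
  Taking for \<open>f\<close> the evaluation at a scalar \<open>c\<close>, this computes the value of the characteristic
  polynomial at \<open>c\<close> as the determinant of \<open>c I - A\<close>.
\<close>

lemma ring_hom_det:
  fixes f :: "'b::comm_ring_1 \<Rightarrow> 'c::comm_ring_1" and A :: "'b^'n^'n::finite"
  assumes add: "\<And>x y. f (x + y) = f x + f y" and mult: "\<And>x y. f (x * y) = f x * f y"
    and one: "f 1 = 1"
  shows "f (det A) = det (map_matrix f A)"
proof -
  have zero: "f 0 = 0"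
    using add[of 0 0] by simp
  have minus: "f (- x) = - f x" for x
    using add[of x "-x"] zero by (simp add: add_eq_0_iff)
  have sum: "f (sum g S) = (\<Sum>x\<in>S. f (g x))" for g :: "('n \<Rightarrow> 'n) \<Rightarrow> 'b" and S
    by (induction S rule: infinite_finite_induct) (auto simp: add zero)
  have prod: "f (prod g S) = (\<Prod>x\<in>S. f (g x))" for g :: "'n \<Rightarrow> 'b" and S
    by (induction S rule: infinite_finite_induct) (auto simp: mult one)
  have "f (of_int (sign p)) = of_int (sign p)" for p :: "'n \<Rightarrow> 'n"
    by (simp add: sign_def one minus)
  then show ?thesis
    by (simp add: det_def sum mult prod map_matrix_def)
qed

lemma eigenvalue_root_charpoly:
  fixes A :: "int^'n^'n::finite" and c :: "'b::{field}"
  assumes "eigenvalue (map_matrix of_int A) c"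
  shows "poly (map_poly of_int (charpoly A)) c = 0"
proof -
  let ?f = "\<lambda>p::int poly. poly (map_poly of_int p) c"
  let ?B = "mat c - map_matrix of_int A :: 'b^'n^'n"
  have "?f (charpoly A) = det (map_matrix ?f (mat [:0, 1:] - map_matrix (\<lambda>c. [:c:]) A))"
    unfolding charpoly_def
    by (rule ring_hom_det) (auto simp: poly_of_int_add poly_of_int_mult)
  also have "map_matrix ?f (mat [:0, 1:] - map_matrix (\<lambda>c. [:c:]) A) = ?B"
  proof -
    have "?f ((if i = j then [:0,1:] else 0) - [:a:]) = (if i = j then c else 0) - of_int a"
      for i j :: 'n and a
    proof -
      have "(if i = j then [:0,1:] else 0) - [:a:] = (if i = j then [:-a,1:] else [:-a:])"
        by simp
      then show ?thesis by (simp add: map_poly_pCons)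
    qed
    then show ?thesis
      by (simp add: vec_eq_iff map_matrix_def mat_def)
  qed
  also have "det ?B = 0"
  proof -
    obtain v where v: "v \<noteq> 0" "map_matrix of_int A *v v = c *s v"
      using assms unfolding eigenvalue_def by auto
    have "?B *v v = 0"
    proof -
      have "mat c *v v = c *s v"
        by (simp add: vec_eq_iff mat_def matrix_vector_mult_def if_distrib[where f="\<lambda>x. x * _"] cong: if_cong)
      then show ?thesis
        using v by (simp add: matrix_vector_mult_diff_rdistrib)
    qed
    then show ?thesis
      using v(1) invertible_det_nz[of ?B] matrix_left_invertible_ker[of ?B] unfolding invertible_def by blast
  qed
  finally show ?thesis .
qed

lemma map_matrix_of_int_complex:
  "map_matrix complex_of_real (map_matrix real_of_int A) = map_matrix of_int A"
  by (simp add: map_matrix_def vec_eq_iff)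

lemma charpoly_transpose: "charpoly (transpose A) = charpoly (A :: int^'n^'n::finite)"
proof -
  have "mat [:0, 1:] - map_matrix (\<lambda>c. [:c:]) (transpose A) = transpose (mat [:0, 1:] - map_matrix (\<lambda>c. [:c:]) A)"
    by (simp add: transpose_def vec_eq_iff mat_def map_matrix_def)
  then show ?thesis
    by (simp add: charpoly_def)
qed

text \<open>
  The polynomial in the definition of a Pisot number and the irreducible characteristic polynomial
  share the root \<open>lam\<close>, hence all their roots.
\<close>

lemma pisot_conjugates_small:
  fixes A :: "int^'n^'n::finite"
  assumes irred: "irreducible (charpoly A)" and pisot: "pisot_number lam"
    and lam: "eigenvalue (map_matrix real_of_int A) lam"
    and c: "poly (map_poly of_int (charpoly A)) c = 0" "c \<noteq> complex_of_real lam"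
  shows "cmod c < 1"
proof -
  obtain p :: "int poly" where p: "irreducible p" "poly (map_poly of_int p) lam = 0"
    "\<And>z::complex. poly (map_poly of_int p) z = 0 \<Longrightarrow> z \<noteq> of_real lam \<Longrightarrow> cmod z < 1"
    using pisot unfolding pisot_number_def by blast
  have "charpoly A dvd p"
    using irred eigenvalue_root_charpoly[OF lam] p(2) by (rule irreducible_int_poly_dvd_of_common_root)
  then have "poly (map_poly of_int p) c = 0"
    using c(1) by (auto simp: poly_of_int_mult elim!: dvdE)
  then show ?thesis
    using p(3) c(2) by blast
qed

section \<open>Decay of orbits of a complex matrix\<close>

text \<open>
  The vector \<open>p(A) x\<close>.
\<close>

definition poly_apply :: "'b::field^'n^'n \<Rightarrow> 'b poly \<Rightarrow> 'b^'n \<Rightarrow> 'b^'n" where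
  "poly_apply A p x = (\<Sum>i\<le>degree p. coeff p i *s ((*v) A ^^ i) x)"

lemma poly_apply_upto:
  assumes "degree p \<le> n"
  shows "poly_apply A p x = (\<Sum>i\<le>n. coeff p i *s ((*v) A ^^ i) x)"
  unfolding poly_apply_def
  by (rule sum.mono_neutral_left) (use assms in \<open>auto simp: coeff_eq_0\<close>)

lemma poly_apply_factor:
  "poly_apply A ([:- c, 1:] * q) x = A *v poly_apply A q x - c *s poly_apply A q x"
proof -
  let ?n = "degree q"
  let ?f = "\<lambda>i. ((*v) A ^^ i) x"
  have "degree ([:- c, 1:] * q) \<le> Suc ?n"
    by (rule order_trans[OF degree_mult_le]) simp
  then have "poly_apply A ([:- c, 1:] * q) x = (\<Sum>i\<le>Suc ?n. coeff ([:- c, 1:] * q) i *s ?f i)"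
    by (rule poly_apply_upto)
  also have "\<dots> = (\<Sum>i\<le>Suc ?n. coeff (pCons 0 q) i *s ?f i) - (\<Sum>i\<le>Suc ?n. (c * coeff q i) *s ?f i)"
    by (simp add: sum_subtractf[symmetric] vec.scale_left_diff_distrib)
  also have "(\<Sum>i\<le>Suc ?n. coeff (pCons 0 q) i *s ?f i) = (\<Sum>i\<le>?n. coeff q i *s ?f (Suc i))"
    by (subst sum.atMost_Suc_shift) simp
  also have "\<dots> = A *v poly_apply A q x"
    by (simp add: poly_apply_def vec.sum vec.scale)
  also have "(\<Sum>i\<le>Suc ?n. (c * coeff q i) *s ?f i) = c *s poly_apply A q x"
    by (simp add: poly_apply_def vec.scale_sum_right coeff_eq_0)
  finally show ?thesis .
qed

lemma funpow_matrix_vector_add: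
  "((*v) A ^^ n) (x + y) = ((*v) A ^^ n) x + ((*v) (A::'b::field^'n^'n) ^^ n) y"
  by (induction n) (auto simp: vec.add)

lemma funpow_matrix_vector_diff:
  "((*v) A ^^ n) (x - y) = ((*v) A ^^ n) x - ((*v) (A::'b::field^'n^'n) ^^ n) y"
  by (induction n) (auto simp: vec.diff)

lemma funpow_matrix_vector_scale:
  "((*v) A ^^ n) (c *s x) = c *s ((*v) (A::'b::field^'n^'n) ^^ n) x"
  by (induction n) (auto simp: vec.scale)

lemma funpow_matrix_vector_sum:
  "((*v) A ^^ n) (sum f S) = (\<Sum>i\<in>S. ((*v) (A::'b::field^'n^'n) ^^ n) (f i))"
  by (induction n) (auto simp: vec.sum)

lemma funpow_matrix_vector_in:
  assumes "\<And>x. x \<in> V \<Longrightarrow> A *v x \<in> V" "x \<in> V"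
  shows "((*v) A ^^ n) x \<in> V"
  by (induction n) (use assms in auto)

lemma poly_apply_commute:
  "poly_apply A q (A *v x - c *s x) = A *v poly_apply A q x - c *s poly_apply A q x"
  unfolding poly_apply_def
  by (simp add: funpow_matrix_vector_diff funpow_matrix_vector_scale funpow_swap1[symmetric]
      vec.sum vec.scale vec.scale_sum_right sum_subtractf[symmetric] vec.scale_right_diff_distrib mult.commute)

lemma exists_linear_relation:
  fixes v :: "nat \<Rightarrow> 'b::field^'n::finite"
  shows "\<exists>c. (\<exists>i\<le>CARD('n). c i \<noteq> 0) \<and> (\<Sum>i\<le>CARD('n). c i *s v i) = 0"
proof (cases "inj_on v {..CARD('n)}")
  case True
  let ?S = "v ` {..CARD('n)}"
  have "card ?S > vec.dim ?S"
    using card_image[OF True] vec.dim_subset[of ?S UNIV] by (simp add: vec_dim_card del: vec.dim_UNIV)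
  then have "vec.dependent ?S"
    using vec.dim_eq_card_independent[of ?S] by auto
  then obtain u where u: "\<exists>y\<in>?S. u y \<noteq> 0" "(\<Sum>y\<in>?S. u y *s y) = 0"
    using vec.dependent_finite[of ?S] by auto
  show ?thesis
    using u by (intro exI[of _ "u \<circ> v"]) (auto simp: sum.reindex[OF True])
next
  case False
  then obtain i j where ij: "i \<le> CARD('n)" "j \<le> CARD('n)" "i \<noteq> j" "v i = v j"
    unfolding inj_on_def by auto
  define c where "c = (\<lambda>k. if k = i then 1 else if k = j then -1 else (0::'b))"
  have "(\<Sum>k\<le>CARD('n). c k *s v k) = (\<Sum>k\<in>{i,j}. c k *s v k)"
    by (rule sum.mono_neutral_right) (use ij in \<open>auto simp: c_def\<close>)
  also have "\<dots> = 0"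
    using ij by (simp add: c_def)
  finally show ?thesis
    using ij by (intro exI[of _ c]) (auto simp: c_def)
qed

text \<open>
  The vectors \<open>x, A x, \<dots>, A\<^sup>d x\<close>, where \<open>d\<close> is the dimension, are linearly dependent.
\<close>

lemma exists_annihilating_poly:
  fixes A :: "'b::field^'n^'n::finite"
  shows "\<exists>p. p \<noteq> 0 \<and> poly_apply A p x = 0"
proof -
  let ?d = "CARD('n)"
  obtain c where c: "\<exists>i\<le>?d. c i \<noteq> 0" "(\<Sum>i\<le>?d. c i *s ((*v) A ^^ i) x) = 0"
    using exists_linear_relation[of "\<lambda>i. ((*v) A ^^ i) x"] by auto
  define p where "p = (\<Sum>i\<le>?d. monom (c i) i)"
  have coeff: "coeff p k = (if k \<le> ?d then c k else 0)" for k
    by (simp add: p_def coeff_sum)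
  have "degree p \<le> ?d"
    by (rule degree_le) (simp add: coeff)
  then have "poly_apply A p x = 0"
    using c(2) by (simp add: poly_apply_upto[of p ?d] coeff)
  moreover have "p \<noteq> 0"
    using c(1) coeff by (metis coeff_0)
  ultimately show ?thesis by blast
qed

lemma norm_vector_scalar_complex: "norm (c *s x) = cmod c * norm (x :: complex^'n::finite)"
  by (simp add: norm_vec_def norm_mult L2_set_right_distrib)

text \<open>
  For \<open>c = \<rho>\<close> the recursion only yields a bound of order \<open>n \<rho>\<^sup>n\<close>; any rate strictly between
  \<open>max c \<rho>\<close> and \<open>1\<close> absorbs the factor \<open>n\<close>.
\<close>

lemma geometric_decay_step:
  fixes c \<rho> :: real and a :: "nat \<Rightarrow> real"
  assumes "0 \<le> c" "c < 1" "0 < \<rho>" "\<rho> < 1" "0 \<le> C" "0 \<le> a 0"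
    and step: "\<And>n. a (Suc n) \<le> c * a n + C * \<rho> ^ n"
  shows "\<exists>C \<rho>. 0 < \<rho> \<and> \<rho> < 1 \<and> 0 \<le> C \<and> (\<forall>n. a n \<le> C * \<rho> ^ n)"
proof -
  define \<sigma> where "\<sigma> = (max c \<rho> + 1) / 2"
  have \<sigma>: "c < \<sigma>" "\<rho> < \<sigma>" "\<sigma> < 1" "0 < \<sigma>"
    using assms unfolding \<sigma>_def by (auto simp: max_def field_simps)
  define K where "K = a 0 + C / (\<sigma> - c)"
  have K: "0 \<le> K" "a 0 \<le> K"
    using \<sigma> assms by (auto simp: K_def)
  have "(\<sigma> - c) * K = (\<sigma> - c) * a 0 + C"
    using \<sigma> by (simp add: K_def distrib_left)
  then have "C \<le> (\<sigma> - c) * K"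
    using \<sigma> assms by simp
  note K = K this
  have "a n \<le> K * \<sigma> ^ n" for n
  proof (induction n)
    case (Suc n)
    have "a (Suc n) \<le> c * (K * \<sigma> ^ n) + C * \<rho> ^ n"
      using step[of n] mult_left_mono[OF Suc assms(1)] by linarith
    also have "C * \<rho> ^ n \<le> ((\<sigma> - c) * K) * \<sigma> ^ n"
      using K \<sigma> assms by (intro mult_mono power_mono) auto
    finally show ?case
      by (simp add: algebra_simps)
  qed (use K in simp)
  then show ?thesis
    using \<sigma> K by blast
qed

text \<open>
  Split the roots off an annihilating polynomial \<open>p\<close> of \<open>x\<close> one at a time, \<open>p = (X - c) q\<close>. If
  \<open>\<bar>c\<bar> < 1\<close>, then \<open>A x - c x\<close> is annihilated by \<open>q\<close>, so its orbit decays, and the orbit of \<open>x\<close> inherits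
  this through \<open>A\<^sup>n\<^sup>+\<^sup>1 x = c A\<^sup>n x + A\<^sup>n (A x - c x)\<close>. Otherwise \<open>c\<close> is not an eigenvalue of \<open>A\<close> on \<open>V\<close>, so
  already \<open>q(A) x = 0\<close>.
\<close>

lemma orbit_decay:
  fixes A :: "complex^'n^'n::finite"
  assumes V: "vec.subspace V" "\<And>x. x \<in> V \<Longrightarrow> A *v x \<in> V"
    and eig: "\<And>c v. v \<in> V \<Longrightarrow> v \<noteq> 0 \<Longrightarrow> A *v v = c *s v \<Longrightarrow> cmod c < 1"
    and x: "x \<in> V"
  shows "\<exists>C \<rho>. 0 < \<rho> \<and> \<rho> < 1 \<and> 0 \<le> C \<and> (\<forall>n. norm (((*v) A ^^ n) x) \<le> C * \<rho> ^ n)"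
proof -
  have main: "\<exists>C \<rho>. 0 < \<rho> \<and> \<rho> < 1 \<and> 0 \<le> C \<and> (\<forall>n. norm (((*v) A ^^ n) x) \<le> C * \<rho> ^ n)"
    if "p \<noteq> 0" "poly_apply A p x = 0" "x \<in> V" for p x
    using that
  proof (induction "degree p" arbitrary: p x)
    case 0
    then obtain c where "p = [:c:]" "c \<noteq> 0"
      by (metis degree_eq_zeroE pCons_0_0)
    then have "x = 0"
      using 0 by (simp add: poly_apply_def)
    then have "((*v) A ^^ n) x = 0" for n
      by (induction n) auto
    then show ?case
      by (intro exI[of _ 0] exI[of _ "1/2"]) auto
  next
    case (Suc d)
    have "\<not> constant (poly p)"
      using Suc.hyps(2) by (simp add: constant_degree)
    then obtain c where "poly p c = 0"
      using fundamental_theorem_of_algebra by blast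
    then obtain q where pq: "p = [:- c, 1:] * q"
      by (metis poly_eq_0_iff_dvd dvdE)
    have "q \<noteq> 0"
      using Suc.prems(1) pq by auto
    have deg: "d = degree q"
      using Suc.hyps(2) \<open>q \<noteq> 0\<close> unfolding pq by (subst (asm) degree_mult_eq) auto
    have kernel: "A *v poly_apply A q x = c *s poly_apply A q x"
      using Suc.prems(2) unfolding pq poly_apply_factor by simp
    have in_V: "poly_apply A q x \<in> V"
      unfolding poly_apply_def
      by (intro vec.subspace_sum[OF V(1)] vec.subspace_scale[OF V(1)] funpow_matrix_vector_in
          V(2) Suc.prems(3))
    show ?case
    proof (cases "cmod c < 1")
      case False
      then have "poly_apply A q x = 0"
        using eig[OF in_V _ kernel] by blast
      then show ?thesis
        using Suc.hyps(1)[OF deg \<open>q \<noteq> 0\<close>] Suc.prems(3) by blast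
    next
      case True
      let ?y = "A *v x - c *s x"
      have "?y \<in> V"
        by (intro vec.subspace_diff[OF V(1)] vec.subspace_scale[OF V(1)] V(2) Suc.prems(3))
      moreover have "poly_apply A q ?y = 0"
        by (simp add: poly_apply_commute kernel)
      ultimately obtain C \<rho> where C: "0 < \<rho>" "\<rho> < 1" "0 \<le> C"
        "\<And>n. norm (((*v) A ^^ n) ?y) \<le> C * \<rho> ^ n"
        using Suc.hyps(1)[OF deg \<open>q \<noteq> 0\<close>] by blast
      show ?thesis
      proof (rule geometric_decay_step[where c="cmod c", OF _ True C(1,2,3)])
        fix n
        have "((*v) A ^^ Suc n) x = c *s ((*v) A ^^ n) x + ((*v) A ^^ n) ?y"
          by (simp add: funpow_matrix_vector_diff funpow_matrix_vector_scale funpow_swap1)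
        then have "norm (((*v) A ^^ Suc n) x) \<le> cmod c * norm (((*v) A ^^ n) x) + norm (((*v) A ^^ n) ?y)"
          by (metis norm_triangle_ineq norm_vector_scalar_complex)
        then show "norm (((*v) A ^^ Suc n) x) \<le> cmod c * norm (((*v) A ^^ n) x) + C * \<rho> ^ n"
          using C(4)[of n] by linarith
      qed auto
    qed
  qed
  obtain p where "p \<noteq> 0" "poly_apply A p x = 0"
    using exists_annihilating_poly by blast
  then show ?thesis
    using main x by blast
qed

section \<open>Contraction transversal to the Perron-Frobenius direction\<close>

lemma matrix_power_apply: "(((**) A) ^^ k) (mat 1) *v x = ((*v) A ^^ k) x"
  for A :: "'b::field^'n^'n"
  by (induction k) (auto simp: matrix_vector_mul_assoc[symmetric])

lemma dot_matrix_vector: "l \<bullet> (A *v x) = (l v* A) \<bullet> (x :: real^'n::finite)"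
  by (simp add: dot_lmul_matrix)

lemma eigenvector_funpow:
  "A *v v = c *s v \<Longrightarrow> ((*v) A ^^ k) v = c ^ k *s v"
  for A :: "'b::field^'n^'n"
  by (induction k) (auto simp: vec.scale mult.commute)

lemma positive_dot_pos:
  assumes "\<forall>i. l $ i > 0" "\<forall>i. r $ i > 0"
  shows "l \<bullet> (r :: real^'n::finite) > 0"
  unfolding inner_vec_def by (rule sum_pos) (use assms in auto)

text \<open>
  The argument of Perron and Frobenius: add the multiple of \<open>r\<close> to \<open>v\<close> that makes it nonnegative with
  some coordinate \<open>0\<close>. This coordinate stays \<open>0\<close> under a positive power of \<open>A\<close>, which is possible for
  the zero vector only. So \<open>v\<close> is a multiple of \<open>r\<close>, and \<open>r\<close> is not orthogonal to \<open>l\<close>.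
\<close>

lemma dominant_eigenspace_transversal:
  fixes A :: "real^'n^'n::finite"
  assumes l: "\<forall>i. l $ i > 0" and r: "\<forall>i. r $ i > 0" "A *v r = lam *s r"
    and prim: "\<forall>i j. (((**) A) ^^ k) (mat 1) $ i $ j > 0"
    and v: "A *v v = lam *s v" "l \<bullet> v = 0"
  shows "v = 0"
proof -
  define t where "t = Max (range (\<lambda>i. - v $ i / r $ i))"
  define u where "u = v + t *s r"
  have "t \<in> range (\<lambda>i. - v $ i / r $ i)"
    unfolding t_def by (rule Max_in) auto
  then obtain j where j: "t = - v $ j / r $ j" by auto
  have r_nz: "r $ i \<noteq> 0" for i
    using r(1) by (metis less_irrefl)
  have u_j: "u $ j = 0"
    using r_nz[of j] by (simp add: u_def j)
  have u_nonneg: "u $ i \<ge> 0" for i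
  proof -
    have "- v $ i / r $ i \<le> t"
      unfolding t_def by (rule Max_ge) auto
    then show ?thesis
      using pos_divide_le_eq[of "r $ i" "- v $ i" t] r(1) by (simp add: u_def)
  qed
  let ?P = "(((**) A) ^^ k) (mat 1)"
  have "A *v u = lam *s u"
    using v(1) r(2) by (simp add: u_def vec.add vec.scale vec.scale_right_distrib mult.commute)
  then have "?P *v u = lam ^ k *s u"
    by (simp add: matrix_power_apply eigenvector_funpow)
  then have "(?P *v u) $ j = 0"
    using u_j by simp
  then have sum0: "(\<Sum>i\<in>UNIV. ?P $ j $ i * u $ i) = 0"
    by (simp add: matrix_vector_mult_def)
  have "u $ i = 0" for i
  proof -
    have "\<forall>i\<in>UNIV. ?P $ j $ i * u $ i = 0"
      using sum0 by (subst (asm) sum_nonneg_eq_0_iff) (use prim u_nonneg in \<open>auto intro!: mult_nonneg_nonneg intro: less_imp_le\<close>)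
    then show ?thesis
      using prim by (metis UNIV_I less_irrefl mult_eq_0_iff)
  qed
  then have "v = (- t) *s r"
    by (simp add: u_def vec_eq_iff eq_neg_iff_add_eq_0)
  moreover have "t = 0"
    using v(2) positive_dot_pos[OF l r(1)] unfolding \<open>v = (- t) *s r\<close>
    by (simp add: scalar_mult_eq_scaleR)
  ultimately show ?thesis by simp
qed

definition complex_vector :: "real^'n \<Rightarrow> complex^'n" where
  "complex_vector x = (\<chi> i. complex_of_real (x $ i))"

lemma complex_vector_mult:
  "map_matrix complex_of_real A *v complex_vector x = complex_vector (A *v (x::real^'n::finite))"
  by (simp add: complex_vector_def matrix_vector_mult_def map_matrix_def vec_eq_iff)

lemma complex_vector_funpow:
  "((*v) (map_matrix complex_of_real A) ^^ k) (complex_vector x) = complex_vector (((*v) A ^^ k) x)"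
  for A :: "real^'n^'n::finite"
  by (induction k) (auto simp: complex_vector_mult)

lemma norm_complex_vector [simp]: "norm (complex_vector x) = norm (x::real^'n::finite)"
  by (simp add: complex_vector_def norm_vec_def)

lemma eigenvalue_complex:
  assumes "eigenvalue A c"
  shows "eigenvalue (map_matrix complex_of_real (A::real^'n^'n::finite)) (complex_of_real c)"
proof -
  obtain v where v: "v \<noteq> 0" "A *v v = c *s v"
    using assms unfolding eigenvalue_def by auto
  have "map_matrix complex_of_real A *v complex_vector v = complex_of_real c *s complex_vector v"
    unfolding complex_vector_mult v(2) by (simp add: complex_vector_def vec_eq_iff)
  moreover have "complex_vector v \<noteq> 0"
    using v(1) by (metis norm_complex_vector norm_eq_zero)
  ultimately show ?thesis
    unfolding eigenvalue_def by blast
qed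

lemma pf_eigenvalue_unique:
  assumes "pf_eigenvalue A a" "pf_eigenvalue A b"
  shows "a = b"
proof (rule ccontr)
  assume "a \<noteq> b"
  have "cmod (complex_of_real a) < b" "cmod (complex_of_real b) < a"
    using assms \<open>a \<noteq> b\<close> eigenvalue_complex unfolding pf_eigenvalue_def by (metis of_real_eq_iff)+
  then show False by simp
qed

text \<open>
  The complexified hyperplane is invariant under \<open>A\<close>, and \<open>lam\<close> is not an eigenvalue of \<open>A\<close> there, since
  the real and imaginary parts of an eigenvector would be eigenvectors as well. So the orbits in it
  decay; expanding a vector in the projections of the standard basis makes the rate uniform.
\<close>

lemma hyperplane_decay:
  fixes A :: "real^'n^'n::finite"
  assumes l: "\<forall>i. l $ i > 0" "l v* A = lam *s l" and r: "\<forall>i. r $ i > 0" "A *v r = lam *s r"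
    and prim: "\<forall>i j. (((**) A) ^^ k) (mat 1) $ i $ j > 0"
    and eig: "\<And>c. eigenvalue (map_matrix complex_of_real A) c \<Longrightarrow> c \<noteq> complex_of_real lam \<Longrightarrow> cmod c < 1"
  shows "\<exists>C \<rho>. 0 < \<rho> \<and> \<rho> < 1 \<and> 0 \<le> C \<and>
    (\<forall>x n. l \<bullet> x = 0 \<longrightarrow> norm (((*v) A ^^ n) x) \<le> C * \<rho> ^ n * norm x)"
proof -
  let ?A = "map_matrix complex_of_real A"
  define V where "V = {x::complex^'n. (\<Sum>i\<in>UNIV. complex_of_real (l $ i) * x $ i) = 0}"
  have subspace: "vec.subspace V"
    by (auto simp: V_def vec.subspace_def algebra_simps sum.distrib sum_distrib_left[symmetric] mult.left_commute)
  have l_col: "(\<Sum>i\<in>UNIV. A $ i $ j * l $ i) = lam * l $ j" for j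
    using l(2) by (simp add: vec_eq_iff vector_matrix_mult_def mult.commute)
  have invariant: "?A *v x \<in> V" if "x \<in> V" for x
  proof -
    have "(\<Sum>i\<in>UNIV. complex_of_real (l $ i) * (?A *v x) $ i)
        = (\<Sum>i\<in>UNIV. \<Sum>j\<in>UNIV. complex_of_real (A $ i $ j * l $ i) * x $ j)"
      by (simp add: matrix_vector_mult_def map_matrix_def sum_distrib_left algebra_simps)
    also have "\<dots> = (\<Sum>j\<in>UNIV. \<Sum>i\<in>UNIV. complex_of_real (A $ i $ j * l $ i) * x $ j)"
      by (rule sum.swap)
    also have "\<dots> = (\<Sum>j\<in>UNIV. complex_of_real (\<Sum>i\<in>UNIV. A $ i $ j * l $ i) * x $ j)"
      by (simp add: sum_distrib_right)
    also have "\<dots> = complex_of_real lam * (\<Sum>j\<in>UNIV. complex_of_real (l $ j) * x $ j)"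
      by (simp add: l_col sum_distrib_left mult.assoc)
    also have "\<dots> = 0"
      using that by (simp add: V_def)
    finally show ?thesis by (simp add: V_def)
  qed
  have eig_V: "cmod c < 1" if v: "v \<in> V" "v \<noteq> 0" "?A *v v = c *s v" for c v
  proof (cases "c = complex_of_real lam")
    case False
    then show ?thesis
      using eig v unfolding eigenvalue_def by blast
  next
    case True
    define a where "a = (\<chi> i. Re (v $ i))"
    define b where "b = (\<chi> i. Im (v $ i))"
    have eq: "(\<Sum>j\<in>UNIV. complex_of_real (A $ i $ j) * v $ j) = complex_of_real lam * v $ i" for i
      using v(3) True by (simp add: vec_eq_iff matrix_vector_mult_def map_matrix_def)
    have "A *v a = lam *s a" "A *v b = lam *s b"
      using arg_cong[OF eq, of Re] arg_cong[OF eq, of Im]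
      by (auto simp: vec_eq_iff matrix_vector_mult_def a_def b_def)
    moreover have "l \<bullet> a = 0" "l \<bullet> b = 0"
      using v(1) by (auto simp: V_def a_def b_def inner_vec_def complex_eq_iff)
    ultimately have "a = 0" "b = 0"
      using dominant_eigenspace_transversal[OF l(1) r prim] by blast+
    then have "v = 0"
      by (simp add: vec_eq_iff a_def b_def complex_eq_iff)
    then show ?thesis
      using v(2) by blast
  qed
  have lr: "l \<bullet> r > 0"
    by (rule positive_dot_pos[OF l(1) r(1)])
  \<comment> \<open>the projection of the \<open>i\<close>-th basis vector onto the hyperplane along \<open>r\<close>\<close>
  define p where "p i = axis i 1 - (l $ i / (l \<bullet> r)) *s r" for i
  have "complex_vector (p i) \<in> V" for i
  proof -
    have "l \<bullet> p i = 0"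
      using lr by (simp add: p_def inner_diff_right scalar_mult_eq_scaleR inner_axis)
    then have "complex_of_real (l \<bullet> p i) = 0"
      by simp
    then show ?thesis
      by (simp add: V_def complex_vector_def inner_vec_def)
  qed
  then have "\<exists>C \<rho>. 0 < \<rho> \<and> \<rho> < 1 \<and> 0 \<le> C \<and> (\<forall>n. norm (((*v) ?A ^^ n) (complex_vector (p i))) \<le> C * \<rho> ^ n)" for i
    by (intro orbit_decay[OF subspace invariant]) (use eig_V in blast)+
  then obtain C \<rho> where C: "\<And>i. 0 < \<rho> i" "\<And>i. \<rho> i < 1" "\<And>i. 0 \<le> C i"
    "\<And>i n. norm (((*v) A ^^ n) (p i)) \<le> C i * \<rho> i ^ n"
    unfolding complex_vector_funpow norm_complex_vector by metis
  define \<sigma> where "\<sigma> = Max (range \<rho>)"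
  have \<sigma>: "\<rho> i \<le> \<sigma>" for i
    unfolding \<sigma>_def by (rule Max_ge) auto
  have "\<sigma> \<in> range \<rho>"
    unfolding \<sigma>_def by (rule Max_in) auto
  then have \<sigma>_bounds: "0 < \<sigma>" "\<sigma> < 1"
    using C by auto
  have "norm (((*v) A ^^ n) x) \<le> (\<Sum>i\<in>UNIV. C i) * \<sigma> ^ n * norm x" if "l \<bullet> x = 0" for x n
  proof -
    have "x = (\<Sum>i\<in>UNIV. x $ i *s p i)"
    proof -
      have "(\<Sum>i\<in>UNIV. x $ i *s p i) = (\<Sum>i\<in>UNIV. x $ i *s axis i 1) - (\<Sum>i\<in>UNIV. (x $ i * (l $ i / (l \<bullet> r))) *s r)"
        by (simp add: p_def vec.scale_right_diff_distrib sum_subtractf)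
      also have "(\<Sum>i\<in>UNIV. x $ i *s axis i 1) = x"
        by (rule basis_expansion)
      also have "(\<Sum>i\<in>UNIV. (x $ i * (l $ i / (l \<bullet> r))) *s r) = ((l \<bullet> x) / (l \<bullet> r)) *s r"
        by (simp add: vec.scale_sum_left[symmetric] inner_vec_def sum_divide_distrib mult.commute)
      finally show ?thesis
        using that by simp
    qed
    then have "((*v) A ^^ n) x = (\<Sum>i\<in>UNIV. x $ i *s ((*v) A ^^ n) (p i))"
      by (metis (no_types, lifting) funpow_matrix_vector_scale funpow_matrix_vector_sum sum.cong)
    then have "norm (((*v) A ^^ n) x) \<le> (\<Sum>i\<in>UNIV. norm (x $ i *s ((*v) A ^^ n) (p i)))"
      by (simp add: norm_sum)
    also have "\<dots> \<le> (\<Sum>i\<in>UNIV. norm x * (C i * \<sigma> ^ n))"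
    proof (rule sum_mono)
      fix i
      have "norm (((*v) A ^^ n) (p i)) \<le> C i * \<sigma> ^ n"
        using C(4)[of n i] mult_left_mono[OF power_mono[OF \<sigma>[of i]] C(3)[of i], of n] C(1)[of i]
        by linarith
      then show "norm (x $ i *s ((*v) A ^^ n) (p i)) \<le> norm x * (C i * \<sigma> ^ n)"
        using component_le_norm_cart[of x i]
        by (simp add: scalar_mult_eq_scaleR mult_mono)
    qed
    also have "\<dots> = (\<Sum>i\<in>UNIV. C i) * \<sigma> ^ n * norm x"
      by (simp add: sum_distrib_left[symmetric] sum_distrib_right[symmetric])
    finally show ?thesis .
  qed
  then show ?thesis
    using \<sigma>_bounds C(3) by (metis sum_nonneg)
qed

lemma transpose_matrix_power:
  fixes A :: "real^'n^'n::finite"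
  shows "(((**) (transpose A)) ^^ k) (mat 1) = transpose ((((**) A) ^^ k) (mat 1))"
proof -
  have commute: "(((**) A) ^^ k) (mat 1) ** A = A ** (((**) A) ^^ k) (mat 1)" for k
    by (induction k) (auto simp: matrix_mul_assoc[symmetric])
  show ?thesis
    by (induction k) (auto simp: transpose_mat matrix_transpose_mul[symmetric] commute)
qed

section \<open>Integer vectors and their projections\<close>

text \<open>
  The orbit of \<open>c\<close> under \<open>A\<close> consists of integer vectors and tends to \<open>0\<close>, so it reaches \<open>0\<close> exactly;
  but \<open>A\<close> is injective.
\<close>

lemma integer_vector_orthogonal_zero:
  fixes A :: "real^'n^'n::finite"
  assumes int: "\<And>i j. A $ i $ j \<in> \<int>" and det: "det A \<noteq> 0"
    and decay: "\<rho> < 1" "0 < \<rho>" "\<And>x n. r \<bullet> x = 0 \<Longrightarrow> norm (((*v) A ^^ n) x) \<le> C * \<rho> ^ n * norm x"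
    and c: "\<And>i. c $ i \<in> \<int>" "r \<bullet> c = 0"
  shows "c = 0"
proof -
  have integral: "((*v) A ^^ n) c $ i \<in> \<int>" for n i
  proof (induction n arbitrary: i)
    case (Suc n)
    then show ?case
      using int by (auto simp: matrix_vector_mult_def intro!: Ints_sum Ints_mult)
  qed (use c in simp)
  have "(\<lambda>n. C * \<rho> ^ n * norm c) \<longlonglongrightarrow> C * 0 * norm c"
    using decay by (intro tendsto_intros LIMSEQ_power_zero) auto
  then have "\<forall>\<^sub>F n in sequentially. C * \<rho> ^ n * norm c < 1"
    by (rule order_tendstoD(2)) simp
  then obtain n where n: "C * \<rho> ^ n * norm c < 1"
    by (auto simp: eventually_sequentially)
  have "((*v) A ^^ n) c $ i = 0" for i
  proof -
    have "\<bar>((*v) A ^^ n) c $ i\<bar> < 1"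
      using component_le_norm_cart[of "((*v) A ^^ n) c" i] decay(3)[OF c(2), of n] n by linarith
    then show ?thesis
      using integral by (metis Ints_nonzero_abs_less1)
  qed
  then have zero: "((*v) A ^^ n) c = 0"
    by (simp add: vec_eq_iff)
  have inj: "x = 0" if "A *v x = 0" for x
    using det that invertible_det_nz[of A] matrix_left_invertible_ker[of A] unfolding invertible_def by blast
  from zero show ?thesis
    by (induction n) (auto dest: inj)
qed

text \<open>
  Kronecker's theorem brings some \<open>t r + x\<close> close to an integer vector, without control over \<open>t\<close>. By
  Dirichlet's theorem there is \<open>q \<ge> 1\<close> such that \<open>q r\<close> is so close to an integer vector that adding
  \<open>K q r\<close>, with \<open>K\<close> as large as needed, hardly changes the quality of the approximation.
\<close>

lemma simultaneous_approximation:
  fixes r x :: "real^'n::finite"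
  assumes indep: "\<And>c. (\<And>i. c $ i \<in> \<int>) \<Longrightarrow> r \<bullet> c = 0 \<Longrightarrow> c = 0" and "\<epsilon> > 0"
  shows "\<exists>z t. (\<forall>i. z $ i \<in> \<int>) \<and> t \<ge> T \<and> norm (z - t *\<^sub>R r - x) < \<epsilon>"
proof -
  define n where "n = CARD('n)"
  have "n > 0" by (simp add: n_def)
  obtain h :: "nat \<Rightarrow> 'n" where h: "bij_betw h {0..<n} UNIV"
    unfolding n_def using ex_bij_betw_nat_finite[of "UNIV::'n set"] by auto
  define g where "g = the_inv_into {0..<n} h"
  have g: "g i < n" "h (g i) = i" for i
    using h the_inv_into_into[of h "{0..<n}" i "{0..<n}"] f_the_inv_into_f_bij_betw[OF h, of i]
    by (auto simp: g_def bij_betw_def)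
  define \<theta> where "\<theta> = (\<lambda>k. r $ h k)"
  interpret Z: Modules.module "(\<lambda>r. (*) (real_of_int r))"
    by (simp add: Modules.module.intro distrib_left mult.commute)
  have inj_r: "i = j" if "r $ i = r $ j" for i j
  proof (rule ccontr)
    assume "i \<noteq> j"
    let ?c = "axis i 1 - axis j 1 :: real^'n"
    have "r \<bullet> ?c = 0"
      using that by (simp add: inner_diff_right inner_axis)
    then have "?c = 0"
      by (rule indep[rotated]) (simp add: axis_def)
    then show False
      using \<open>i \<noteq> j\<close> by (simp add: axis_eq_axis)
  qed
  have inj: "inj_on \<theta> {..<n}"
    unfolding \<theta>_def using h by (auto simp: inj_on_def bij_betw_def dest!: inj_r)
  have image: "\<theta> ` {..<n} = range (($) r)"
  proof -
    have "\<theta> ` {..<n} = ($) r ` (h ` {0..<n})"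
      by (auto simp: \<theta>_def atLeast0LessThan)
    then show ?thesis
      using h by (simp add: bij_betw_def)
  qed
  have "\<not> Z.dependent (\<theta> ` {..<n})"
  proof
    assume "Z.dependent (\<theta> ` {..<n})"
    then obtain u where u: "\<exists>v\<in>range (($) r). u v \<noteq> 0" "(\<Sum>v\<in>range (($) r). real_of_int (u v) * v) = 0"
      unfolding image using Z.dependent_finite[of "range (($) r)"] by auto
    define c :: "real^'n" where "c = (\<chi> i. real_of_int (u (r $ i)))"
    have "r \<bullet> c = (\<Sum>i\<in>UNIV. real_of_int (u (r $ i)) * r $ i)"
      by (simp add: inner_vec_def c_def mult.commute)
    also have "\<dots> = (\<Sum>v\<in>range (($) r). real_of_int (u v) * v)"
      by (subst sum.reindex) (auto intro: injI dest: inj_r)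
    finally have "c = 0"
      using u(2) by (intro indep) (auto simp: c_def)
    then show False
      using u(1) by (auto simp: c_def vec_eq_iff)
  qed
  define \<delta> where "\<delta> = \<epsilon> / (2 * real n)"
  have "\<delta> > 0"
    using \<open>\<epsilon> > 0\<close> \<open>n > 0\<close> by (simp add: \<delta>_def)
  obtain t m where m: "\<And>k. k < n \<Longrightarrow> \<bar>t * \<theta> k - of_int (m k) - (- x $ h k)\<bar> < \<delta>"
    using Kronecker_thm_1[OF \<open>\<not> Z.dependent (\<theta> ` {..<n})\<close> inj \<open>\<delta> > 0\<close>, of "\<lambda>k. - x $ h k"] by blast
  \<comment> \<open>after adding \<open>K q r\<close> with \<open>q \<ge> 1\<close> the multiplier is at least \<open>t + K \<ge> T\<close>, at the cost of an error \<open>K / N\<close>\<close>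
  obtain K :: nat where K: "real K \<ge> T - t"
    using real_arch_simple by blast
  obtain N :: nat where N: "real N > real K / \<delta>" "N > 0"
    by (metis reals_Archimedean2 gr0I less_le_trans not_less of_nat_0 divide_nonneg_pos \<open>\<delta> > 0\<close> of_nat_0_le_iff)
  obtain q p where q: "0 < q" and p: "\<And>k. k < n \<Longrightarrow> \<bar>of_int q * \<theta> k - of_int (p k)\<bar> < 1 / real N"
    using Dirichlet_approx_simult[OF N(2)] by metis
  define z :: "real^'n" where "z = (\<chi> i. real_of_int (m (g i) + int K * p (g i)))"
  define s where "s = t + real K * real_of_int q"
  have "\<bar>(z - s *\<^sub>R r - x) $ i\<bar> < 2 * \<delta>" for i
  proof -
    have "real K * \<bar>of_int q * r $ i - of_int (p (g i))\<bar> \<le> real K * (1 / real N)"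
      using p[OF g(1)[of i]] by (intro mult_left_mono) (auto simp: \<theta>_def g)
    moreover have "real K * (1 / real N) < \<delta>"
      using N \<open>\<delta> > 0\<close> by (simp add: field_simps)
    ultimately have "\<bar>real K * (of_int q * r $ i - of_int (p (g i)))\<bar> < \<delta>"
      by (simp add: abs_mult)
    moreover have "\<bar>t * r $ i - of_int (m (g i)) + x $ i\<bar> < \<delta>"
      using m[OF g(1)[of i]] by (simp add: \<theta>_def g)
    moreover have "(z - s *\<^sub>R r - x) $ i
      = - (real K * (of_int q * r $ i - of_int (p (g i)))) - (t * r $ i - of_int (m (g i)) + x $ i)"
      by (simp add: z_def s_def algebra_simps)
    ultimately show ?thesis by linarith
  qed
  then have "(\<Sum>i\<in>UNIV. \<bar>(z - s *\<^sub>R r - x) $ i\<bar>) < (\<Sum>i\<in>(UNIV::'n set). 2 * \<delta>)"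
    by (intro sum_strict_mono) auto
  also have "\<dots> = \<epsilon>"
    using \<open>n > 0\<close> by (simp add: \<delta>_def n_def)
  finally have "norm (z - s *\<^sub>R r - x) < \<epsilon>"
    using norm_le_l1_cart[of "z - s *\<^sub>R r - x"] by linarith
  moreover have "s \<ge> T"
  proof -
    have "real K * 1 \<le> real K * real_of_int q"
      using q by (intro mult_left_mono) auto
    then show ?thesis
      using K by (simp add: s_def)
  qed
  moreover have "\<forall>i. z $ i \<in> \<int>"
    by (simp add: z_def)
  ultimately show ?thesis by blast
qed

text \<open>
  The coordinate sum of \<open>z\<close> differs by a bounded amount from \<open>t\<close> times that of \<open>r\<close>, which is positive.
\<close>

lemma simultaneous_approximation_nonneg:
  fixes r x :: "real^'n::finite"
  assumes indep: "\<And>c. (\<And>i. c $ i \<in> \<int>) \<Longrightarrow> r \<bullet> c = 0 \<Longrightarrow> c = 0" and r: "\<forall>i. r $ i > 0" and "\<epsilon> > 0"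
  shows "\<exists>z t. (\<forall>i. z $ i \<in> \<int>) \<and> (\<Sum>i\<in>UNIV. z $ i) \<ge> 0 \<and> norm (z - t *\<^sub>R r - x) < \<epsilon>"
proof -
  let ?s = "\<lambda>y::real^'n. \<Sum>i\<in>UNIV. y $ i"
  have pos: "?s r > 0"
    using r by (intro sum_pos) auto
  define T where "T = (real CARD('n) * \<epsilon> - ?s x) / ?s r"
  obtain z t where z: "\<forall>i. z $ i \<in> \<int>" "t \<ge> T" "norm (z - t *\<^sub>R r - x) < \<epsilon>"
    using simultaneous_approximation[OF indep \<open>\<epsilon> > 0\<close>, where T=T and x=x] by blast
  have "T * ?s r \<le> t * ?s r"
    using z(2) pos by simp
  then have "real CARD('n) * \<epsilon> - ?s x \<le> t * ?s r"
    using pos by (simp add: T_def)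
  moreover have "?s (z - t *\<^sub>R r - x) \<ge> (\<Sum>i\<in>(UNIV::'n set). - \<epsilon>)"
  proof (rule sum_mono)
    fix i
    show "- \<epsilon> \<le> (z - t *\<^sub>R r - x) $ i"
      using component_le_norm_cart[of "z - t *\<^sub>R r - x" i] z(3) by linarith
  qed
  moreover have "?s (z - t *\<^sub>R r - x) = ?s z - t * ?s r - ?s x"
    by (simp add: sum_subtractf sum_distrib_left)
  ultimately have "?s z \<ge> 0" by simp
  then show ?thesis
    using z by blast
qed

definition zero_sum_lattice :: "(real^'n::finite) set" where
  "zero_sum_lattice = {z. (\<forall>i. z $ i \<in> \<int>) \<and> (\<Sum>i\<in>UNIV. z $ i) = 0}"

lemma countable_zero_sum_lattice: "countable (zero_sum_lattice :: (real^'n::finite) set)"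
proof (rule countable_subset)
  show "zero_sum_lattice \<subseteq> range (\<lambda>f::'n \<Rightarrow> int. \<chi> i. real_of_int (f i))"
  proof
    fix z :: "real^'n" assume "z \<in> zero_sum_lattice"
    then have "z = (\<chi> i. real_of_int \<lfloor>z $ i\<rfloor>)"
      by (simp add: zero_sum_lattice_def vec_eq_iff)
    then show "z \<in> range (\<lambda>f::'n \<Rightarrow> int. \<chi> i. real_of_int (f i))"
      by (rule range_eqI[where x="\<lambda>i. \<lfloor>z $ i\<rfloor>"])
  qed
qed simp

lemma finite_bounded_integral_vectors: "finite {z::real^'n::finite. \<forall>i. z $ i \<in> \<int> \<and> \<bar>z $ i\<bar> \<le> K}"
proof (rule finite_subset)
  show "{z::real^'n. \<forall>i. z $ i \<in> \<int> \<and> \<bar>z $ i\<bar> \<le> K} \<subseteq> vec_lambda ` (Pi\<^sub>E UNIV (\<lambda>_. {k\<in>\<int>. \<bar>k\<bar> \<le> K}))"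
  proof
    fix z :: "real^'n" assume "z \<in> {z. \<forall>i. z $ i \<in> \<int> \<and> \<bar>z $ i\<bar> \<le> K}"
    then have "($) z \<in> Pi\<^sub>E UNIV (\<lambda>_. {k\<in>\<int>. \<bar>k\<bar> \<le> K})"
      by auto
    then show "z \<in> vec_lambda ` (Pi\<^sub>E UNIV (\<lambda>_. {k\<in>\<int>. \<bar>k\<bar> \<le> K}))"
      by (rule rev_image_eqI) (simp add: vec_nth_inverse)
  qed
  show "finite (vec_lambda ` (Pi\<^sub>E UNIV (\<lambda>_::'n. {k\<in>\<int>. \<bar>k\<bar> \<le> K})))"
    by (intro finite_imageI finite_PiE finite_abs_int_segment) simp
qed

section \<open>Iterated substitution of words and sequences\<close>

lemma subst_word_Nil [simp]: "subst_word \<theta> [] = {[]}"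
  by (auto simp: subst_word_def)

lemma subst_word_Cons: "subst_word \<theta> (a # u) = {v @ x | v x. v \<in> \<theta> a \<and> x \<in> subst_word \<theta> u}"
proof -
  have "\<exists>v x. concat vs = v @ x \<and> v \<in> \<theta> a \<and> x \<in> subst_word \<theta> u"
    if "list_all2 (\<lambda>v a. v \<in> \<theta> a) vs (a # u)" for vs
  proof -
    obtain v ws where "vs = v # ws" "v \<in> \<theta> a" "list_all2 (\<lambda>v a. v \<in> \<theta> a) ws u"
      using \<open>list_all2 _ vs (a # u)\<close> by (auto simp: list_all2_Cons2)
    then show ?thesis
      by (intro exI[of _ v] exI[of _ "concat ws"]) (auto simp: subst_word_def)
  qed
  moreover have "v @ concat vs \<in> subst_word \<theta> (a # u)"
    if "v \<in> \<theta> a" "list_all2 (\<lambda>v a. v \<in> \<theta> a) vs u" for v vs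
    unfolding subst_word_def using that by (intro CollectI exI[of _ "v # vs"]) auto
  ultimately show ?thesis
    unfolding subst_word_def by blast
qed

lemma subst_word_append:
  "x \<in> subst_word \<theta> (u @ v) \<longleftrightarrow> (\<exists>y z. x = y @ z \<and> y \<in> subst_word \<theta> u \<and> z \<in> subst_word \<theta> v)"
proof (induction u arbitrary: x)
  case (Cons a u)
  show ?case
  proof
    assume "x \<in> subst_word \<theta> ((a # u) @ v)"
    then obtain p y z where "x = p @ y @ z" "p \<in> \<theta> a" "y \<in> subst_word \<theta> u" "z \<in> subst_word \<theta> v"
      unfolding append_Cons subst_word_Cons mem_Collect_eq Cons by blast
    then show "\<exists>y z. x = y @ z \<and> y \<in> subst_word \<theta> (a # u) \<and> z \<in> subst_word \<theta> v"
      by (intro exI[of _ "p @ y"] exI[of _ z]) (auto simp: subst_word_Cons)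
  next
    assume "\<exists>y z. x = y @ z \<and> y \<in> subst_word \<theta> (a # u) \<and> z \<in> subst_word \<theta> v"
    then obtain p y z where "x = p @ y @ z" "p \<in> \<theta> a" "y \<in> subst_word \<theta> u" "z \<in> subst_word \<theta> v"
      unfolding subst_word_Cons by auto
    then show "x \<in> subst_word \<theta> ((a # u) @ v)"
      unfolding append_Cons subst_word_Cons mem_Collect_eq Cons by blast
  qed
qed simp

lemma subst_word_singleton [simp]: "subst_word \<theta> [a] = \<theta> a"
  by (auto simp: subst_word_Cons)

lemma subst_word_iter_0 [simp]: "subst_word_iter \<theta> 0 u = {u}"
  by (simp add: subst_word_iter_def)

lemma subst_word_iter_Suc:
  "subst_word_iter \<theta> (Suc n) u = (\<Union>v\<in>subst_word_iter \<theta> n u. subst_word \<theta> v)"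
  by (simp add: subst_word_iter_def)

lemma subst_word_iter_1 [simp]: "subst_word_iter \<theta> (Suc 0) u = subst_word \<theta> u"
  by (simp add: subst_word_iter_Suc)

lemma subst_word_iter_append:
  "x \<in> subst_word_iter \<theta> n (u @ v) \<longleftrightarrow>
   (\<exists>y z. x = y @ z \<and> y \<in> subst_word_iter \<theta> n u \<and> z \<in> subst_word_iter \<theta> n v)"
proof (induction n arbitrary: x)
  case (Suc n)
  show ?case
    unfolding subst_word_iter_Suc UN_iff Bex_def Suc
  proof
    assume "\<exists>w. (\<exists>y z. w = y @ z \<and> y \<in> subst_word_iter \<theta> n u \<and> z \<in> subst_word_iter \<theta> n v) \<and> x \<in> subst_word \<theta> w"
    then show "\<exists>y z. x = y @ z \<and> (\<exists>w. w \<in> subst_word_iter \<theta> n u \<and> y \<in> subst_word \<theta> w) \<and>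
        (\<exists>w. w \<in> subst_word_iter \<theta> n v \<and> z \<in> subst_word \<theta> w)"
      using subst_word_append by blast
  next
    assume "\<exists>y z. x = y @ z \<and> (\<exists>w. w \<in> subst_word_iter \<theta> n u \<and> y \<in> subst_word \<theta> w) \<and>
        (\<exists>w. w \<in> subst_word_iter \<theta> n v \<and> z \<in> subst_word \<theta> w)"
    then show "\<exists>w. (\<exists>y z. w = y @ z \<and> y \<in> subst_word_iter \<theta> n u \<and> z \<in> subst_word_iter \<theta> n v) \<and> x \<in> subst_word \<theta> w"
      using subst_word_append by blast
  qed
qed simp

lemma subst_word_iter_appendI:
  "y \<in> subst_word_iter \<theta> n u \<Longrightarrow> z \<in> subst_word_iter \<theta> n v \<Longrightarrow> y @ z \<in> subst_word_iter \<theta> n (u @ v)"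
  using subst_word_iter_append by blast

lemma subst_word_iter_Cons:
  "x \<in> subst_word_iter \<theta> n (a # u) \<longleftrightarrow>
   (\<exists>y z. x = y @ z \<and> y \<in> subst_word_iter \<theta> n [a] \<and> z \<in> subst_word_iter \<theta> n u)"
  using subst_word_iter_append[of x \<theta> n "[a]" u] by simp

lemma subst_word_iter_Nil [simp]: "subst_word_iter \<theta> n [] = {[]}"
  by (induction n) (auto simp: subst_word_iter_Suc)

lemma subst_word_iter_add:
  "subst_word_iter \<theta> (m + n) u = (\<Union>v\<in>subst_word_iter \<theta> m u. subst_word_iter \<theta> n v)"
  by (induction n) (auto simp: subst_word_iter_Suc)

lemma subst_word_iter_addI:
  "v \<in> subst_word_iter \<theta> m u \<Longrightarrow> x \<in> subst_word_iter \<theta> n v \<Longrightarrow> x \<in> subst_word_iter \<theta> (m + n) u"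
  unfolding subst_word_iter_add by blast

lemma finite_subst_word:
  assumes "random_substitution \<theta>"
  shows "finite (subst_word \<theta> u)"
proof (induction u)
  case (Cons a u)
  have "subst_word \<theta> (a # u) = (\<lambda>(v, x). v @ x) ` (\<theta> a \<times> subst_word \<theta> u)"
    by (auto simp: subst_word_Cons)
  then show ?case
    using Cons assms by (auto simp: random_substitution_def)
qed simp

lemma finite_subst_word_iter:
  assumes "random_substitution \<theta>"
  shows "finite (subst_word_iter \<theta> n u)"
  by (induction n) (auto simp: subst_word_iter_Suc finite_subst_word[OF assms])

lemma subst_word_nonempty:
  assumes "random_substitution \<theta>"
  shows "\<exists>v. v \<in> subst_word \<theta> u"
proof (induction u)
  case (Cons a u)
  moreover have "\<exists>v. v \<in> \<theta> a"
    using assms unfolding random_substitution_def by blast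
  ultimately show ?case
    unfolding subst_word_Cons by blast
qed simp

lemma subst_word_iter_nonempty:
  assumes "random_substitution \<theta>"
  shows "\<exists>v. v \<in> subst_word_iter \<theta> n u"
proof (induction n)
  case (Suc n)
  then show ?case
    unfolding subst_word_iter_Suc using subst_word_nonempty[OF assms] by blast
qed simp

lemma length_subst_word:
  assumes "random_substitution \<theta>"
  shows "v \<in> subst_word \<theta> u \<Longrightarrow> length u \<le> length v"
proof (induction u arbitrary: v)
  case (Cons a u)
  then obtain x y where "v = x @ y" "x \<in> \<theta> a" "length u \<le> length y"
    by (auto simp: subst_word_Cons)
  moreover have "x \<noteq> []"
    using \<open>x \<in> \<theta> a\<close> assms by (metis random_substitution_def)
  then have "length x \<ge> 1"
    by (cases x) auto
  ultimately show ?case by simp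
qed simp

lemma length_subst_word_iter:
  assumes "random_substitution \<theta>"
  shows "v \<in> subst_word_iter \<theta> n u \<Longrightarrow> length u \<le> length v"
proof (induction n arbitrary: v)
  case (Suc n)
  then show ?case
    using length_subst_word[OF assms] by (auto simp: subst_word_iter_Suc intro: order_trans)
qed simp

text \<open>
  Cut before the block that contains the letter following \<open>p\<close>: \<open>v2\<close> is that block, the image of
  the letter \<open>e\<close> of \<open>t\<close>.
\<close>

lemma prefix_letter_decomposition:
  assumes "v \<in> subst_word_iter \<theta> n t" "prefix (p @ [b]) v"
  shows "\<exists>t1 e p1 p2 v2. prefix (t1 @ [e]) t \<and> p = p1 @ p2 \<and> p1 \<in> subst_word_iter \<theta> n t1 \<and>
           v2 \<in> subst_word_iter \<theta> n [e] \<and> prefix (p2 @ [b]) v2"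
  using assms
proof (induction t arbitrary: v p)
  case Nil
  then show ?case by simp
next
  case (Cons a t)
  obtain x y where v: "v = x @ y" "x \<in> subst_word_iter \<theta> n [a]" "y \<in> subst_word_iter \<theta> n t"
    using Cons.prems(1) unfolding subst_word_iter_Cons[of v] by blast
  show ?case
  proof (cases "prefix (p @ [b]) x")
    case True
    then show ?thesis
      using v by (intro exI[of _ "[]"] exI[of _ a] exI[of _ "[]"] exI[of _ p] exI[of _ x]) auto
  next
    case False
    then obtain q where q: "p @ [b] = x @ q" "prefix q y"
      using Cons.prems(2) unfolding v(1) prefix_append by blast
    then have "q \<noteq> []"
      using False by auto
    then obtain p' where "q = p' @ [b]" "p = x @ p'"
      using q(1) by (cases q rule: rev_cases) auto
    then obtain t1 e p1 p2 v2 where *: "prefix (t1 @ [e]) t" "p' = p1 @ p2" "p1 \<in> subst_word_iter \<theta> n t1"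
      "v2 \<in> subst_word_iter \<theta> n [e]" "prefix (p2 @ [b]) v2"
      using Cons.IH[OF v(3)] q(2) by blast
    have "x @ p1 \<in> subst_word_iter \<theta> n (a # t1)"
      using subst_word_iter_appendI[OF v(2) *(3)] by simp
    then show ?thesis
      using * \<open>p = x @ p'\<close>
      by (intro exI[of _ "a # t1"] exI[of _ e] exI[of _ "x @ p1"] exI[of _ p2] exI[of _ v2]) auto
  qed
qed

lemma prefix_decomposition:
  assumes "v \<in> subst_word_iter \<theta> n t" "prefix p v"
  shows "\<exists>t1 p1 p2. prefix t1 t \<and> p = p1 @ p2 \<and> p1 \<in> subst_word_iter \<theta> n t1 \<and>
           (p2 = [] \<or> (\<exists>e. \<exists>v2\<in>subst_word_iter \<theta> n [e]. prefix p2 v2))"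
proof (cases p rule: rev_cases)
  case Nil
  then show ?thesis
    by (intro exI[of _ "[]"]) auto
next
  case (snoc q b)
  then obtain t1 e p1 p2 v2 where *: "prefix (t1 @ [e]) t" "q = p1 @ p2" "p1 \<in> subst_word_iter \<theta> n t1"
      "v2 \<in> subst_word_iter \<theta> n [e]" "prefix (p2 @ [b]) v2"
    using prefix_letter_decomposition[OF assms(1), of q b] assms(2) by blast
  have "prefix t1 t"
    using *(1) by (rule append_prefixD)
  moreover have "p = p1 @ (p2 @ [b])"
    by (simp add: snoc *(2))
  ultimately show ?thesis
    using *(3,4,5) by blast
qed

lemma subst_seq_prefix:
  assumes "y \<in> subst_seq \<theta> x"
  shows "\<exists>u\<in>subst_word \<theta> (factor x 0 k). factor y 0 (length u) = u"
proof -
  obtain v where v: "\<And>i. v i \<in> \<theta> (x i)"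
    "\<And>n. factor y 0 (length (concat (map v [0..<n]))) = concat (map v [0..<n])"
    using assms by (auto simp: subst_seq_def Let_def)
  have "list_all2 (\<lambda>v a. v \<in> \<theta> a) (map v [0..<k]) (factor x 0 k)"
    using v(1) by (simp add: factor_def list_all2_conv_all_nth)
  then have "concat (map v [0..<k]) \<in> subst_word \<theta> (factor x 0 k)"
    unfolding subst_word_def by blast
  then show ?thesis
    using v(2) by blast
qed

lemma subst_seq_iter_prefix:
  assumes "y \<in> subst_seq_iter \<theta> n X"
  shows "\<exists>x\<in>X. \<forall>k. \<exists>u\<in>subst_word_iter \<theta> n (factor x 0 k). factor y 0 (length u) = u"
  using assms
proof (induction n arbitrary: y)
  case 0
  then show ?case
    by (intro bexI[of _ y]) (auto simp: subst_seq_iter_def factor_def)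
next
  case (Suc n)
  then obtain z where z: "z \<in> subst_seq_iter \<theta> n X" "y \<in> subst_seq \<theta> z"
    by (auto simp: subst_seq_iter_def)
  obtain x where x: "x \<in> X"
    "\<And>k. \<exists>u\<in>subst_word_iter \<theta> n (factor x 0 k). factor z 0 (length u) = u"
    using Suc.IH[OF z(1)] by blast
  have "\<exists>u\<in>subst_word_iter \<theta> (Suc n) (factor x 0 k). factor y 0 (length u) = u" for k
  proof -
    obtain u where u: "u \<in> subst_word_iter \<theta> n (factor x 0 k)" "factor z 0 (length u) = u"
      using x(2)[of k] by blast
    obtain u' where "u' \<in> subst_word \<theta> u" "factor y 0 (length u') = u'"
      using subst_seq_prefix[OF z(2), of "length u"] u(2) by auto
    then show ?thesis
      using u(1) unfolding subst_word_iter_Suc by blast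
  qed
  then show ?case
    using x(1) by blast
qed

lemma length_factor [simp]: "length (factor x i j) = j - i"
  by (simp add: factor_def)

lemma factor_append: "i \<le> j \<Longrightarrow> j \<le> k \<Longrightarrow> factor x i j @ factor x j k = factor x i k"
  unfolding factor_def map_append[symmetric] using upt_add_eq_append[of i j "k - j"] by simp

lemma factor_Suc: "i \<le> j \<Longrightarrow> factor x i (Suc j) = factor x i j @ [x j]"
  by (simp add: factor_def)

lemma prefix_factor:
  assumes "prefix u (factor x 0 k)"
  shows "u = factor x 0 (length u)"
proof -
  have "u = take (length u) (factor x 0 k)" "length u \<le> length (factor x 0 k)"
    using assms prefix_length_le[OF assms] by (auto simp: prefix_def)
  then show ?thesis
    by (simp add: factor_def take_map)
qed

lemma prefix_factor_mono: "j \<le> k \<Longrightarrow> prefix (factor x 0 j) (factor x 0 k)"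
  using factor_append[of 0 j k x] by (metis le0 prefixI)

text \<open>
  The sequences that agree with \<open>y\<close> in the first \<open>n\<close> places form an open neighbourhood of \<open>y\<close>.
\<close>

lemma dense_orbit_occurrence:
  assumes "has_dense_orbit \<theta> w" "y \<in> subst_space \<theta>"
  shows "\<exists>k. factor w k (k + n) = factor y 0 n"
proof -
  define U where "U = {z. \<forall>i<n. z i = y i}"
  have "openin seq_topology U"
  proof -
    have "U = Pi\<^sub>E UNIV (\<lambda>i. if i < n then {y i} else UNIV)"
      by (auto simp: U_def PiE_def Pi_def split: if_splits)
    moreover have "openin seq_topology (Pi\<^sub>E UNIV (\<lambda>i. if i < n then {y i} else UNIV))"
      unfolding seq_topology_def
    proof (rule product_topology_basis)
      have "{i. (if i < n then {y i} else UNIV) \<noteq> UNIV} \<subseteq> {..<n}"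
        by auto
      then show "finite {i. (if i < n then {y i} else UNIV) \<noteq> topspace (discrete_topology UNIV)}"
        by (simp add: finite_subset)
    qed auto
    ultimately show ?thesis by simp
  qed
  then have "openin (subtopology seq_topology (subst_space \<theta>)) (subst_space \<theta> \<inter> U)"
    by (rule openin_subtopology_Int2)
  moreover have "y \<in> subst_space \<theta> \<inter> U"
    using assms(2) by (simp add: U_def)
  moreover have "y \<in> subtopology seq_topology (subst_space \<theta>) closure_of shift_orbit w"
    using assms unfolding has_dense_orbit_def by simp
  ultimately have "\<exists>z. z \<in> shift_orbit w \<and> z \<in> subst_space \<theta> \<inter> U"
    unfolding in_closure_of by blast
  then obtain k where "\<And>i. i < n \<Longrightarrow> w (k + i) = y i"
    by (auto simp: shift_orbit_def U_def)
  then have "factor w k (k + n) = factor y 0 n"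
    by (intro nth_equalityI) (auto simp: factor_def)
  then show ?thesis by blast
qed

text \<open>
  What the combinatorics of words uses of primitivity and of the dominant eigenvalue exceeding \<open>1\<close>.
\<close>

locale mixing_substitution =
  fixes \<theta> :: "'a \<Rightarrow> 'a list set" and k0 :: nat
  assumes rs: "random_substitution \<theta>"
    and mixing: "\<And>a b v. v \<in> subst_word_iter \<theta> k0 [a] \<Longrightarrow> b \<in> set v"
    and growth: "\<And>L. \<exists>n a v. v \<in> subst_word_iter \<theta> n [a] \<and> L \<le> length v"
begin

text \<open>
  Since \<open>x\<close> may sit at the end of the word that makes it legal, that word is realised again as a block
  that is followed by further blocks.
\<close>

lemma legal_extend:
  assumes "legal \<theta> x"
  shows "\<exists>b. legal \<theta> (x @ [b])"
proof -
  obtain a k v where v: "v \<in> subst_word_iter \<theta> k [a]" "sublist x v"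
    using assms unfolding legal_def by blast
  obtain L c z where z: "z \<in> subst_word_iter \<theta> L [c]" "2 \<le> length z"
    using growth by blast
  then obtain z1 z2 z' where z_eq: "z = z1 # z2 # z'"
    by (cases z; cases "tl z") auto
  obtain y1 where y1: "y1 \<in> subst_word_iter \<theta> k0 [z1]"
    using subst_word_iter_nonempty[OF rs] by blast
  obtain y2 where y2: "y2 \<in> subst_word_iter \<theta> k0 (z2 # z')"
    using subst_word_iter_nonempty[OF rs] by blast
  obtain s1 s2 where s: "y1 = s1 @ [a] @ s2"
    using mixing[OF y1, of a] by (auto simp: in_set_conv_decomp)
  obtain t1 where t1: "t1 \<in> subst_word_iter \<theta> k s1"
    using subst_word_iter_nonempty[OF rs] by blast
  obtain t2 where t2: "t2 \<in> subst_word_iter \<theta> k (s2 @ y2)"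
    using subst_word_iter_nonempty[OF rs] by blast
  have "length (s2 @ y2) > 0"
    using length_subst_word_iter[OF rs y2] by auto
  then have "t2 \<noteq> []"
    using length_subst_word_iter[OF rs t2] by auto
  have "y1 @ y2 \<in> subst_word_iter \<theta> k0 z"
    using subst_word_iter_appendI[OF y1 y2] by (simp add: z_eq)
  moreover have "t1 @ v @ t2 \<in> subst_word_iter \<theta> k (y1 @ y2)"
    using subst_word_iter_appendI[OF t1 subst_word_iter_appendI[OF v(1) t2]] by (simp add: s)
  ultimately have in_iter: "t1 @ v @ t2 \<in> subst_word_iter \<theta> (L + (k0 + k)) [c]"
    using z(1) subst_word_iter_addI by metis
  obtain \<alpha> \<beta> where ab: "v = \<alpha> @ x @ \<beta>"
    using v(2) by (auto simp: sublist_def)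
  obtain b \<gamma> where "\<beta> @ t2 = b # \<gamma>"
    using \<open>t2 \<noteq> []\<close> by (cases "\<beta> @ t2") auto
  then have "t1 @ v @ t2 = (t1 @ \<alpha>) @ (x @ [b]) @ \<gamma>"
    by (simp add: ab)
  then have "sublist (x @ [b]) (t1 @ v @ t2)"
    by (metis sublist_def)
  then show ?thesis
    using in_iter unfolding legal_def by blast
qed

lemma legal_sublist: "legal \<theta> v \<Longrightarrow> sublist u v \<Longrightarrow> legal \<theta> u"
  unfolding legal_def by (meson sublist_order.order_trans)

lemma legal_extend_seq:
  assumes "legal \<theta> x"
  shows "\<exists>y\<in>subst_space \<theta>. factor y 0 (length x) = x"
proof -
  define X where "X = rec_nat x (\<lambda>_ u. u @ [SOME b. legal \<theta> (u @ [b])])"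
  have X_0: "X 0 = x" and X_Suc: "X (Suc n) = X n @ [SOME b. legal \<theta> (X n @ [b])]" for n
    by (simp_all add: X_def)
  have legal_X: "legal \<theta> (X n)" for n
  proof (induction n)
    case (Suc n)
    then show ?case
      unfolding X_Suc using legal_extend someI_ex[of "\<lambda>b. legal \<theta> (X n @ [b])"] by blast
  qed (simp add: X_0 assms)
  have len: "length (X n) = length x + n" for n
    by (induction n) (auto simp: X_0 X_Suc)
  define y where "y i = X (Suc i) ! i" for i
  have stable: "X (n + m) ! i = X n ! i" if "i < length (X n)" for n m i
    using that by (induction m) (auto simp: X_Suc nth_append len)
  have nth: "X n ! i = y i" if "i < length x + n" for n i
    using stable[of i n "Suc i"] stable[of i "Suc i" n] that unfolding y_def len
    by (simp add: add.commute)
  have factor: "factor y 0 (length x + n) = X n" for n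
    by (intro nth_equalityI) (auto simp: factor_def len nth)
  have "legal \<theta> (factor y i j)" for i j
  proof (cases "i \<le> j")
    case True
    have "X j = factor y 0 i @ factor y i j @ factor y j (length x + j)"
      using True by (simp add: factor[symmetric] factor_append)
    then show ?thesis
      using legal_sublist[OF legal_X[of j]] by (metis sublist_def)
  next
    case False
    then show ?thesis
      using legal_sublist[OF assms, of "[]"] by (simp add: factor_def)
  qed
  then show ?thesis
    using factor[of 0] by (intro bexI[of _ y]) (auto simp: subst_space_def X_0)
qed

text \<open>
  One letter of \<open>z\<close> is spent on each pair \<open>(c, v)\<close>: its image after \<open>k0\<close> steps contains \<open>c\<close>, and this
  occurrence of \<open>c\<close> is realised as \<open>v\<close>. The part of the word before \<open>v\<close> is the image of a prefix \<open>u\<close>,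
  hence of a legal word if \<open>z\<close> arises from a letter, so that its projection is small.
\<close>

lemma realisation_of_all_blocks:
  assumes "\<And>c v. (c, v) \<in> set ps \<Longrightarrow> v \<in> subst_word_iter \<theta> n [c]" and "length ps \<le> length z"
  shows "\<exists>x\<in>subst_word_iter \<theta> (k0 + n) z. \<forall>c v. (c, v) \<in> set ps \<longrightarrow> (\<exists>u t x1 x2.
           t \<in> subst_word_iter \<theta> k0 z \<and> prefix u t \<and> x1 \<in> subst_word_iter \<theta> n u \<and> x = x1 @ v @ x2)"
  using assms
proof (induction ps arbitrary: z)
  case Nil
  then show ?case
    using subst_word_iter_nonempty[OF rs] by auto
next
  case (Cons cv ps)
  obtain c v where cv: "cv = (c, v)" by (cases cv)
  obtain a z' where z: "z = a # z'"
    using Cons.prems(2) by (cases z) auto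
  obtain x' where x': "x' \<in> subst_word_iter \<theta> (k0 + n) z'"
    and IH: "\<And>c v. (c, v) \<in> set ps \<Longrightarrow> \<exists>u t x1 x2.
           t \<in> subst_word_iter \<theta> k0 z' \<and> prefix u t \<and> x1 \<in> subst_word_iter \<theta> n u \<and> x' = x1 @ v @ x2"
  proof -
    have "\<exists>x\<in>subst_word_iter \<theta> (k0 + n) z'. \<forall>c v. (c, v) \<in> set ps \<longrightarrow> (\<exists>u t x1 x2.
           t \<in> subst_word_iter \<theta> k0 z' \<and> prefix u t \<and> x1 \<in> subst_word_iter \<theta> n u \<and> x = x1 @ v @ x2)"
      using Cons.prems z by (intro Cons.IH) auto
    then show ?thesis
      using that by meson
  qed
  obtain t where t: "t \<in> subst_word_iter \<theta> k0 [a]"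
    using subst_word_iter_nonempty[OF rs] by blast
  obtain s1 s2 where s: "t = s1 @ [c] @ s2"
    using mixing[OF t, of c] by (auto simp: in_set_conv_decomp)
  obtain y1 y2 where y: "y1 \<in> subst_word_iter \<theta> n s1" "y2 \<in> subst_word_iter \<theta> n s2"
    using subst_word_iter_nonempty[OF rs] by blast
  have v: "v \<in> subst_word_iter \<theta> n [c]"
    using Cons.prems(1) cv by simp
  have block: "y1 @ v @ y2 \<in> subst_word_iter \<theta> n t"
    unfolding s by (intro subst_word_iter_appendI y v)
  let ?x = "(y1 @ v @ y2) @ x'"
  have "?x \<in> subst_word_iter \<theta> (k0 + n) ([a] @ z')"
    by (intro subst_word_iter_appendI subst_word_iter_addI[OF t block] x')
  moreover have "\<exists>u t x1 x2. t \<in> subst_word_iter \<theta> k0 z \<and> prefix u t \<and>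
      x1 \<in> subst_word_iter \<theta> n u \<and> ?x = x1 @ v' @ x2" if "(c', v') \<in> set (cv # ps)" for c' v'
  proof (cases "(c', v') = cv")
    case True
    obtain t' where "t' \<in> subst_word_iter \<theta> k0 z'"
      using subst_word_iter_nonempty[OF rs] by blast
    then have "t @ t' \<in> subst_word_iter \<theta> k0 z"
      using subst_word_iter_appendI[OF t] by (simp add: z)
    then show ?thesis
      using True cv y(1) by (intro exI[of _ s1] exI[of _ "t @ t'"] exI[of _ y1] exI[of _ "y2 @ x'"]) (simp add: s)
  next
    case False
    then have "(c', v') \<in> set ps"
      using that by auto
    then obtain u t' x1 x2 where *: "t' \<in> subst_word_iter \<theta> k0 z'" "prefix u t'"
      "x1 \<in> subst_word_iter \<theta> n u" "x' = x1 @ v' @ x2"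
      using IH by meson
    have "t @ t' \<in> subst_word_iter \<theta> k0 z"
      using subst_word_iter_appendI[OF t *(1)] by (simp add: z)
    moreover have "(y1 @ v @ y2) @ x1 \<in> subst_word_iter \<theta> n (t @ u)"
      by (rule subst_word_iter_appendI[OF block *(3)])
    ultimately show ?thesis
      using * by (intro exI[of _ "t @ u"] exI[of _ "t @ t'"] exI[of _ "(y1 @ v @ y2) @ x1"] exI[of _ x2]) simp
  qed
  ultimately show ?case
    unfolding z append_Cons append_Nil by (intro bexI[of _ ?x] allI impI)
qed

end

section \<open>Abelianisation and the contraction of legal words\<close>

lemma abelianisation_append: "abelianisation (u @ v) = abelianisation u + abelianisation v"
  by (simp add: abelianisation_def vec_eq_iff)

lemma abelianisation_Nil [simp]: "abelianisation [] = 0"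
  by (simp add: abelianisation_def vec_eq_iff)

lemma abelianisation_singleton: "abelianisation [a] = axis a 1"
  by (simp add: abelianisation_def vec_eq_iff axis_def)

lemma sum_abelianisation: "(\<Sum>i\<in>UNIV. abelianisation u $ i) = real (length u)"
proof (induction u)
  case (Cons a u)
  have "abelianisation (a # u) = axis a 1 + abelianisation u"
    using abelianisation_append[of "[a]" u] by (simp add: abelianisation_singleton)
  then show ?case
    using Cons by (simp add: sum.distrib axis_def)
qed simp

lemma abelianisation_integral: "abelianisation u $ i \<in> \<int>"
  by (simp add: abelianisation_def)

lemma abelianisation_subst_word:
  assumes "\<And>v a. v \<in> \<theta> a \<Longrightarrow> abelianisation v = A *v axis a 1"
  shows "v \<in> subst_word \<theta> u \<Longrightarrow> abelianisation v = A *v abelianisation u"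
proof (induction u arbitrary: v)
  case (Cons a u)
  then obtain x y where "v = x @ y" "x \<in> \<theta> a" "y \<in> subst_word \<theta> u"
    by (auto simp: subst_word_Cons)
  moreover have "abelianisation (a # u) = axis a 1 + abelianisation u"
    using abelianisation_append[of "[a]" u] by (simp add: abelianisation_singleton)
  ultimately show ?case
    using Cons.IH assms by (simp add: abelianisation_append matrix_vector_right_distrib)
qed simp

lemma abelianisation_subst_word_iter:
  assumes "\<And>v a. v \<in> \<theta> a \<Longrightarrow> abelianisation v = A *v axis a 1"
  shows "v \<in> subst_word_iter \<theta> n u \<Longrightarrow> abelianisation v = ((*v) A ^^ n) (abelianisation u)"
  by (induction n arbitrary: v) (auto simp: subst_word_iter_Suc abelianisation_subst_word[OF assms])

lemma factor_prefix_letter: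
  assumes "factor w k (k + length x) = x" "prefix (q @ [b]) x"
  shows "factor w k (k + length q) = q" "w (k + length q) = b"
proof -
  obtain s where x: "x = (q @ [b]) @ s"
    using assms(2) by (auto simp: prefix_def)
  have "factor w k (k + length x) = factor w k (k + length q) @ [w (k + length q)] @ factor w (Suc (k + length q)) (k + length x)"
    using factor_append[of k "Suc (k + length q)" "k + length x" w] by (simp add: factor_Suc x)
  then have "factor w k (k + length q) @ [w (k + length q)] @ factor w (Suc (k + length q)) (k + length x) = q @ [b] @ s"
    using assms(1) x by simp
  then show "factor w k (k + length q) = q" "w (k + length q) = b"
    by (auto simp: append_eq_append_conv)
qed

text \<open>
  Here \<open>A\<close> is the substitution matrix, whose powers contract the hyperplane orthogonal to \<open>l\<close> at rate
  \<open>\<rho>\<close>; the last assumption says that the coordinates of \<open>r\<close> are rationally independent.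
\<close>

locale pisot_substitution = mixing_substitution \<theta> k0
  for \<theta> :: "'a::finite \<Rightarrow> 'a list set" and k0 +
  fixes A :: "real^'a^'a" and l r :: "real^'a" and lam C \<rho> :: real
  assumes abel_letter: "\<And>v a. v \<in> \<theta> a \<Longrightarrow> abelianisation v = A *v axis a 1"
    and l_pos: "\<forall>i. l $ i > 0" and l_eig: "l v* A = lam *s l"
    and r_pos: "\<forall>i. r $ i > 0" and r_eig: "A *v r = lam *s r"
    and lam: "lam > 1" and det: "det A \<noteq> 0"
    and rho: "0 < \<rho>" "\<rho> < 1" and C_nonneg: "0 \<le> C"
    and decay: "\<And>x n. l \<bullet> x = 0 \<Longrightarrow> norm (((*v) A ^^ n) x) \<le> C * \<rho> ^ n * norm x"
    and indep: "\<And>c. (\<And>i. c $ i \<in> \<int>) \<Longrightarrow> r \<bullet> c = 0 \<Longrightarrow> c = 0"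
begin

abbreviation "\<pi> \<equiv> proj_along l r"
abbreviation "M n x \<equiv> ((*v) A ^^ n) x"

lemma lr: "l \<bullet> r > 0"
  by (rule positive_dot_pos[OF l_pos r_pos])

lemma proj_add: "\<pi> (x + y) = \<pi> x + \<pi> y"
  by (simp add: proj_along_def inner_add_right add_divide_distrib scaleR_left_distrib)

lemma proj_diff: "\<pi> (x - y) = \<pi> x - \<pi> y"
  by (simp add: proj_along_def inner_diff_right diff_divide_distrib scaleR_left_diff_distrib)

lemma proj_scaleR: "\<pi> (c *\<^sub>R x) = c *\<^sub>R \<pi> x"
  by (simp add: proj_along_def scaleR_right_diff_distrib)

lemma proj_0 [simp]: "\<pi> 0 = 0"
  by (simp add: proj_along_def)

lemma proj_r [simp]: "\<pi> r = 0"
  using lr by (simp add: proj_along_def)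

lemma linear_proj: "linear \<pi>"
  by (intro linearI proj_add proj_scaleR)

lemma dot_proj [simp]: "l \<bullet> \<pi> x = 0"
  using lr by (simp add: proj_along_def inner_diff_right)

lemma proj_id: "l \<bullet> x = 0 \<Longrightarrow> \<pi> x = x"
  by (simp add: proj_along_def)

lemma dot_mult: "l \<bullet> (A *v x) = lam * (l \<bullet> x)"
  by (simp add: dot_matrix_vector l_eig scalar_mult_eq_scaleR)

lemma dot_M: "l \<bullet> M n x = lam ^ n * (l \<bullet> x)"
  by (induction n) (auto simp: dot_mult)

lemma proj_mult: "\<pi> (A *v x) = A *v \<pi> x"
  by (simp add: proj_along_def dot_mult matrix_vector_mult_diff_distrib r_eig
      scalar_mult_eq_scaleR matrix_vector_mult_scaleR)

lemma proj_M: "\<pi> (M n x) = M n (\<pi> x)"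
  by (induction n) (auto simp: proj_mult)

lemma linear_M: "linear (\<lambda>x. M n x)"
  by (intro linearI) (auto simp: funpow_matrix_vector_add funpow_matrix_vector_scale scalar_mult_eq_scaleR[symmetric])

lemma abelianisation_iter:
  "v \<in> subst_word_iter \<theta> n u \<Longrightarrow> abelianisation v = M n (abelianisation u)"
  by (rule abelianisation_subst_word_iter) (auto intro: abel_letter)

lemma legal_prefix: "v \<in> subst_word_iter \<theta> N [c] \<Longrightarrow> prefix p v \<Longrightarrow> legal \<theta> p"
  unfolding legal_def by (meson prefix_imp_sublist)

text \<open>
  Let \<open>v\<close> be a realisation of \<open>v'\<close>. Cut at the last boundary of a block, \<open>p\<close> is a realisation of a prefix \<open>t\<close> of
  \<open>v'\<close> followed by a word \<open>s\<close> from a finite set, so \<open>A\<^sup>n \<pi>\<psi>(p) = A\<^sup>n\<^sup>+\<^sup>1 \<pi>\<psi>(t) + A\<^sup>n \<pi>\<psi>(s)\<close>.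
  The constant \<open>D\<close> is the fixed point of the resulting recursion \<open>D = D \<rho> + C B\<close>.
\<close>

lemma prefix_contraction:
  "\<exists>D\<ge>0. \<forall>N c v p n. v \<in> subst_word_iter \<theta> N [c] \<longrightarrow> prefix p v \<longrightarrow>
     norm (M n (\<pi> (abelianisation p))) \<le> D * \<rho> ^ n"
proof -
  \<comment> \<open>the prefixes of single letters serve the base case, where nothing has been substituted yet\<close>
  define W where "W = (\<Union>c. set (prefixes [c])) \<union> (\<Union>c. \<Union>v\<in>\<theta> c. set (prefixes v))"
  have "finite W"
    using rs by (auto simp: W_def random_substitution_def)
  then have "bounded ((\<lambda>s. \<pi> (abelianisation s)) ` W)"
    by (intro finite_imp_bounded finite_imageI)
  then obtain B where "\<And>s. s \<in> W \<Longrightarrow> norm (\<pi> (abelianisation s)) \<le> B" and "B > 0"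
    unfolding bounded_pos by auto
  have B: "norm (M n (\<pi> (abelianisation s))) \<le> (C * B) * \<rho> ^ n" if "s \<in> W" for s n
  proof -
    have "norm (M n (\<pi> (abelianisation s))) \<le> C * \<rho> ^ n * norm (\<pi> (abelianisation s))"
      by (rule decay) simp
    also have "\<dots> \<le> C * \<rho> ^ n * B"
      using \<open>s \<in> W\<close> \<open>\<And>s. s \<in> W \<Longrightarrow> norm (\<pi> (abelianisation s)) \<le> B\<close> C_nonneg rho
      by (intro mult_left_mono) auto
    finally show ?thesis by (simp add: algebra_simps)
  qed
  define D where "D = C * B / (1 - \<rho>)"
  have D: "D * \<rho> + C * B = D" "D \<ge> 0"
    using rho C_nonneg \<open>B > 0\<close> by (auto simp: D_def field_simps)
  have "0 \<le> D * \<rho>"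
    using D(2) rho by simp
  then have "C * B \<le> D"
    using D(1) by linarith
  have "norm (M n (\<pi> (abelianisation p))) \<le> D * \<rho> ^ n"
    if "v \<in> subst_word_iter \<theta> N [c]" "prefix p v" for N c v p n
    using that
  proof (induction N arbitrary: v p n)
    case 0
    then have "p \<in> W"
      by (auto simp: W_def prefix_Cons)
    then have "norm (M n (\<pi> (abelianisation p))) \<le> (C * B) * \<rho> ^ n"
      by (rule B)
    also have "\<dots> \<le> D * \<rho> ^ n"
      using \<open>C * B \<le> D\<close> rho by (intro mult_right_mono) auto
    finally show ?case .
  next
    case (Suc N)
    then obtain v' where v': "v' \<in> subst_word_iter \<theta> N [c]" "v \<in> subst_word_iter \<theta> (Suc 0) v'"
      by (auto simp: subst_word_iter_Suc)
    obtain t p1 p2 where t: "prefix t v'" "p = p1 @ p2" "p1 \<in> subst_word_iter \<theta> (Suc 0) t"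
      and p2: "p2 = [] \<or> (\<exists>e. \<exists>v2\<in>subst_word_iter \<theta> (Suc 0) [e]. prefix p2 v2)"
      using prefix_decomposition[OF v'(2) Suc.prems(2)] by blast
    have "p2 \<in> W"
      using p2 by (auto simp: W_def)
    have "M n (\<pi> (abelianisation p)) = M (Suc n) (\<pi> (abelianisation t)) + M n (\<pi> (abelianisation p2))"
      using abelianisation_iter[OF t(3)]
      by (simp add: t(2) abelianisation_append proj_add funpow_matrix_vector_add proj_mult funpow_swap1)
    then have "norm (M n (\<pi> (abelianisation p))) \<le> D * \<rho> ^ Suc n + (C * B) * \<rho> ^ n"
      using norm_triangle_le Suc.IH[OF v'(1) t(1), of "Suc n"] B[OF \<open>p2 \<in> W\<close>, of n] add_mono by metis
    also have "\<dots> = (D * \<rho> + C * B) * \<rho> ^ n"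
      by (simp add: algebra_simps)
    finally show ?case
      unfolding D(1) .
  qed
  then show ?thesis
    using D(2) by blast
qed

lemma legal_contraction:
  "\<exists>E\<ge>0. \<forall>u n. legal \<theta> u \<longrightarrow> norm (M n (\<pi> (abelianisation u))) \<le> E * \<rho> ^ n"
proof -
  obtain D where D: "D \<ge> 0" "\<And>N c v p n. v \<in> subst_word_iter \<theta> N [c] \<Longrightarrow> prefix p v \<Longrightarrow>
     norm (M n (\<pi> (abelianisation p))) \<le> D * \<rho> ^ n"
    using prefix_contraction by blast
  have "norm (M n (\<pi> (abelianisation u))) \<le> (2 * D) * \<rho> ^ n" if u: "legal \<theta> u" for u n
  proof -
    obtain a k v where v: "v \<in> subst_word_iter \<theta> k [a]" "sublist u v"
      using u unfolding legal_def by blast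
    obtain x z where xz: "v = x @ u @ z"
      using v(2) by (auto simp: sublist_def)
    have eq: "M n (\<pi> (abelianisation u)) = M n (\<pi> (abelianisation (x @ u))) - M n (\<pi> (abelianisation x))"
      by (simp add: abelianisation_append proj_add funpow_matrix_vector_add)
    have "norm (M n (\<pi> (abelianisation (x @ u)))) \<le> D * \<rho> ^ n"
      "norm (M n (\<pi> (abelianisation x))) \<le> D * \<rho> ^ n"
      by (rule D(2)[OF v(1)]; simp add: xz)+
    then show ?thesis
      unfolding eq
      using norm_triangle_ineq4[of "M n (\<pi> (abelianisation (x @ u)))" "M n (\<pi> (abelianisation x))"]
      by linarith
  qed
  then show ?thesis
    using D(1) by (intro exI[of _ "2 * D"]) auto
qed

text \<open>
  These are the sets \<open>T\<^sub>n\<^sub>,\<^sub>b\<close> of the introduction.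
\<close>

definition approximant :: "nat \<Rightarrow> 'a \<Rightarrow> (real^'a) set" where
  "approximant n b = {\<pi> (abelianisation p) | p c v. v \<in> subst_word_iter \<theta> n [c] \<and> prefix (p @ [b]) v}"

end

section \<open>Subtiles and their finite approximations\<close>

lemma slope_le:
  fixes a b c :: real
  assumes "\<And>j::nat. real j * a \<le> b + real j * c"
  shows "a \<le> c"
proof (rule ccontr)
  assume "\<not> a \<le> c"
  then obtain j :: nat where "b < real j * (a - c)"
    using reals_Archimedean3[of "a - c"] by auto
  then show False
    using assms[of j] by (simp add: algebra_simps)
qed

text \<open>
  A sequence \<open>w\<close> that defines the Rauzy fractal, together with a constant \<open>E\<close> as provided by
  \<open>legal_contraction\<close>.
\<close>

locale rauzy_fractal = pisot_substitution +
  fixes w E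
  assumes w_infinity: "w \<in> subst_space_infinity \<theta>" and dense: "has_dense_orbit \<theta> w"
    and E_nonneg: "0 \<le> E"
    and contraction: "\<And>u n. legal \<theta> u \<Longrightarrow> norm (M n (\<pi> (abelianisation u))) \<le> E * \<rho> ^ n"
begin

definition S where "S b = \<pi> ` prefix_vectors w b"

abbreviation R where "R b \<equiv> rauzy_subtile l r w b"

lemma R_closure: "R b = closure (S b)"
  by (simp add: rauzy_subtile_def S_def)

lemma S_I: "w m = b \<Longrightarrow> \<pi> (abelianisation (factor w 0 m)) \<in> S b"
  unfolding S_def prefix_vectors_def by blast

lemma S_E:
  assumes "x \<in> S b"
  obtains m where "w m = b" "x = \<pi> (abelianisation (factor w 0 m))"
  using assms unfolding S_def prefix_vectors_def by blast

lemma w_in_space: "w \<in> subst_space \<theta>"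
proof -
  have "w \<in> subst_seq_iter \<theta> 0 (subst_space \<theta>)"
    using w_infinity unfolding subst_space_infinity_def by blast
  then show ?thesis
    by (simp add: subst_seq_iter_def)
qed

lemma legal_factor: "y \<in> subst_space \<theta> \<Longrightarrow> legal \<theta> (factor y i j)"
  by (simp add: subst_space_def)

lemma S_dot: "x \<in> S b \<Longrightarrow> l \<bullet> x = 0"
  by (auto elim: S_E)

lemma S_contraction: "x \<in> S b \<Longrightarrow> norm (M n x) \<le> E * \<rho> ^ n"
  by (auto elim!: S_E intro!: contraction legal_factor w_in_space)

text \<open>
  If \<open>w\<close> lies in the image of \<open>y\<close> under the \<open>n\<close>-th iterate, a prefix of \<open>w\<close> is an image of a prefix of \<open>y\<close>,
  whose projection contributes \<open>O(\<rho>\<^sup>n)\<close>, followed by part of the image of one letter.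
\<close>

lemma S_near_approximant:
  assumes "x \<in> S b"
  shows "\<exists>t\<in>approximant n b. norm (x - t) \<le> E * \<rho> ^ n"
proof -
  obtain m where m: "w m = b" "x = \<pi> (abelianisation (factor w 0 m))"
    using assms by (rule S_E)
  have "w \<in> subst_seq_iter \<theta> n (subst_space \<theta>)"
    using w_infinity unfolding subst_space_infinity_def by blast
  then obtain y where y: "y \<in> subst_space \<theta>"
    "\<And>k. \<exists>u\<in>subst_word_iter \<theta> n (factor y 0 k). factor w 0 (length u) = u"
    using subst_seq_iter_prefix by blast
  obtain u where u: "u \<in> subst_word_iter \<theta> n (factor y 0 (Suc m))" "factor w 0 (length u) = u"
    using y(2) by blast
  have "Suc m \<le> length u"
    using length_subst_word_iter[OF rs u(1)] by simp
  then have "prefix (factor w 0 m @ [b]) u"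
    using prefix_factor_mono[of "Suc m" "length u" w] u(2) m(1) by (simp add: factor_Suc)
  then obtain t1 e p1 p2 v2 where *: "prefix (t1 @ [e]) (factor y 0 (Suc m))" "factor w 0 m = p1 @ p2"
    "p1 \<in> subst_word_iter \<theta> n t1" "v2 \<in> subst_word_iter \<theta> n [e]" "prefix (p2 @ [b]) v2"
    using prefix_letter_decomposition[OF u(1)] by blast
  have "t1 = factor y 0 (length t1)"
    using append_prefixD[OF *(1)] by (rule prefix_factor)
  then have "legal \<theta> t1"
    using legal_factor[OF y(1)] by metis
  have "x - \<pi> (abelianisation p2) = M n (\<pi> (abelianisation t1))"
    using abelianisation_iter[OF *(3)] by (simp add: m(2) *(2) abelianisation_append proj_add proj_M)
  then have "norm (x - \<pi> (abelianisation p2)) \<le> E * \<rho> ^ n"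
    using contraction[OF \<open>legal \<theta> t1\<close>] by simp
  moreover have "\<pi> (abelianisation p2) \<in> approximant n b"
    unfolding approximant_def using * by blast
  ultimately show ?thesis by blast
qed

text \<open>
  A legal word that contains every element of every \<open>\<theta>\<^sup>n(c)\<close> as a block occurs in \<open>w\<close>, but at a
  place \<open>k\<close> that is unrelated to a given way of cutting \<open>w\<close> into blocks. So the projected prefix
  vector \<open>\<delta>\<close> of that place need not be small a priori.
\<close>

lemma approximant_near_translate:
  "\<exists>\<delta>. \<forall>b. \<forall>t\<in>approximant n b. \<exists>x\<in>S b. norm (t + \<delta> - x) \<le> E * \<rho> ^ n"
proof -
  have "finite (SIGMA c:UNIV. subst_word_iter \<theta> n [c])"
    by (intro finite_SigmaI finite_subst_word_iter rs) simp
  then obtain ps where ps: "set ps = (SIGMA c:UNIV. subst_word_iter \<theta> n [c])"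
    using finite_list by blast
  \<comment> \<open>\<open>z\<close> needs one letter for each of the blocks in \<open>ps\<close>\<close>
  obtain L a z where z: "z \<in> subst_word_iter \<theta> L [a]" "length ps \<le> length z"
    using growth by blast
  have "\<exists>x\<in>subst_word_iter \<theta> (k0 + n) z. \<forall>c v. (c, v) \<in> set ps \<longrightarrow> (\<exists>u t x1 x2.
           t \<in> subst_word_iter \<theta> k0 z \<and> prefix u t \<and> x1 \<in> subst_word_iter \<theta> n u \<and> x = x1 @ v @ x2)"
    by (rule realisation_of_all_blocks) (use ps z in auto)
  then obtain x where x: "x \<in> subst_word_iter \<theta> (k0 + n) z"
    "\<And>c v. v \<in> subst_word_iter \<theta> n [c] \<Longrightarrow> \<exists>u t x1 x2.
           t \<in> subst_word_iter \<theta> k0 z \<and> prefix u t \<and> x1 \<in> subst_word_iter \<theta> n u \<and> x = x1 @ v @ x2"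
    using ps by auto
  have "legal \<theta> x"
    using subst_word_iter_addI[OF z(1) x(1)] legal_prefix by blast
  then obtain y where y: "y \<in> subst_space \<theta>" "factor y 0 (length x) = x"
    using legal_extend_seq by blast
  obtain k where k: "factor w k (k + length x) = x"
    using dense_orbit_occurrence[OF dense y(1), of "length x"] y(2) by auto
  define \<delta> where "\<delta> = \<pi> (abelianisation (factor w 0 k))"
  have "\<exists>x\<in>S b. norm (t + \<delta> - x) \<le> E * \<rho> ^ n" if t: "t \<in> approximant n b" for b t
  proof -
    obtain p c v where p: "t = \<pi> (abelianisation p)" "v \<in> subst_word_iter \<theta> n [c]" "prefix (p @ [b]) v"
      using t unfolding approximant_def by blast
    obtain u t' x1 x2 where u: "t' \<in> subst_word_iter \<theta> k0 z" "prefix u t'"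
      "x1 \<in> subst_word_iter \<theta> n u" "x = x1 @ v @ x2"
      using x(2)[OF p(2)] by blast
    have "prefix ((x1 @ p) @ [b]) x"
      using p(3) by (auto simp: u(4) prefix_def)
    then have occ: "factor w k (k + length (x1 @ p)) = x1 @ p" "w (k + length (x1 @ p)) = b"
      using factor_prefix_letter[OF k] by blast+
    let ?x = "\<pi> (abelianisation (factor w 0 (k + length (x1 @ p))))"
    have "?x \<in> S b"
      using occ(2) by (rule S_I)
    have "legal \<theta> u"
      using legal_prefix[OF subst_word_iter_addI[OF z(1) u(1)] u(2)] .
    have "factor w 0 (k + length (x1 @ p)) = factor w 0 k @ (x1 @ p)"
      using factor_append[of 0 k "k + length (x1 @ p)" w] occ(1) by simp
    then have "t + \<delta> - ?x = - M n (\<pi> (abelianisation u))"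
      using abelianisation_iter[OF u(3)]
      by (simp add: p(1) \<delta>_def abelianisation_append proj_add proj_M)
    then have "norm (t + \<delta> - ?x) \<le> E * \<rho> ^ n"
      using contraction[OF \<open>legal \<theta> u\<close>] by simp
    then show ?thesis
      using \<open>?x \<in> S b\<close> by blast
  qed
  then show ?thesis by blast
qed

text \<open>
  Going from \<open>S b\<close> to the approximant and back by way of the translation, \<open>S b + \<delta>\<close> lies within \<open>2 e\<close>
  of \<open>S b\<close>, where \<open>e = E \<rho>\<^sup>n\<close>. Hence \<open>S b + j \<delta>\<close> lies within \<open>2 j e\<close> of \<open>S b\<close>, and as \<open>S b\<close> is bounded,
  dividing by \<open>j\<close> yields \<open>\<bar>\<delta>\<bar> \<le> 2 e\<close>.
\<close>

lemma approximant_near_S: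
  assumes "t \<in> approximant n b"
  shows "\<exists>x\<in>S b. norm (t - x) \<le> 3 * E * \<rho> ^ n"
proof -
  let ?e = "E * \<rho> ^ n"
  obtain \<delta> where \<delta>: "\<And>b t. t \<in> approximant n b \<Longrightarrow> \<exists>x\<in>S b. norm (t + \<delta> - x) \<le> ?e"
    using approximant_near_translate by blast
  have step: "\<exists>x'\<in>S b. norm (x + \<delta> - x') \<le> 2 * ?e" if x: "x \<in> S b" for x b
  proof -
    obtain t where t: "t \<in> approximant n b" "norm (x - t) \<le> ?e"
      using S_near_approximant[OF x] by blast
    obtain x' where x': "x' \<in> S b" "norm (t + \<delta> - x') \<le> ?e"
      using \<delta>[OF t(1)] by blast
    have "norm ((x - t) + (t + \<delta> - x')) \<le> ?e + ?e"
      using t(2) x'(2) by (rule norm_triangle_mono)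
    moreover have "(x - t) + (t + \<delta> - x') = x + \<delta> - x'"
      by simp
    ultimately show ?thesis
      using x'(1) by auto
  qed
  have iterate: "\<exists>x'\<in>S b. norm (x + real j *\<^sub>R \<delta> - x') \<le> real j * (2 * ?e)" if "x \<in> S b" for x b j
  proof (induction j)
    case 0
    then show ?case
      using that by (intro bexI[of _ x]) auto
  next
    case (Suc j)
    then obtain y where y: "y \<in> S b" "norm (x + real j *\<^sub>R \<delta> - y) \<le> real j * (2 * ?e)" by blast
    obtain y' where y': "y' \<in> S b" "norm (y + \<delta> - y') \<le> 2 * ?e"
      using step[OF y(1)] by blast
    have "norm ((x + real j *\<^sub>R \<delta> - y) + (y + \<delta> - y')) \<le> real j * (2 * ?e) + 2 * ?e"
      using y(2) y'(2) by (rule norm_triangle_mono)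
    moreover have "(x + real j *\<^sub>R \<delta> - y) + (y + \<delta> - y') = x + real (Suc j) *\<^sub>R \<delta> - y'"
      by (simp add: algebra_simps)
    ultimately have "norm (x + real (Suc j) *\<^sub>R \<delta> - y') \<le> real (Suc j) * (2 * ?e)"
      by (simp add: algebra_simps)
    then show ?case
      using y'(1) by blast
  qed
  have "real j * norm \<delta> \<le> 2 * E + real j * (2 * ?e)" for j
  proof -
    obtain x where x: "x \<in> S (w 0)"
      using S_I[of 0] by blast
    obtain x' where x': "x' \<in> S (w 0)" "norm (x + real j *\<^sub>R \<delta> - x') \<le> real j * (2 * ?e)"
      using iterate[OF x] by blast
    have "real j *\<^sub>R \<delta> = (x + real j *\<^sub>R \<delta> - x') + (x' - x)"
      by simp
    then have "norm (real j *\<^sub>R \<delta>) \<le> norm (x + real j *\<^sub>R \<delta> - x') + norm (x' - x)"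
      by (metis norm_triangle_ineq)
    moreover have "norm (x' - x) \<le> E + E"
      using norm_triangle_ineq4[of x' x] S_contraction[OF x, of 0] S_contraction[OF x'(1), of 0] by simp
    ultimately show ?thesis
      using x'(2) by simp
  qed
  then have small: "norm \<delta> \<le> 2 * ?e"
    by (rule slope_le)
  obtain x where x: "x \<in> S b" "norm (t + \<delta> - x) \<le> ?e"
    using \<delta>[OF assms] by blast
  have "norm (t - x) \<le> norm (t + \<delta> - x) + norm \<delta>"
    using norm_triangle_ineq4[of "t + \<delta> - x" \<delta>] by simp
  then show ?thesis
    using x small by (intro bexI[of _ x]) auto
qed

lemma rho_power_small:
  assumes "\<epsilon> > 0"
  shows "\<exists>N. K * \<rho> ^ N < \<epsilon>"
proof -
  have "(\<lambda>n. K * \<rho> ^ n) \<longlonglongrightarrow> K * 0"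
    using rho by (intro tendsto_intros LIMSEQ_power_zero) auto
  then have "\<forall>\<^sub>F n in sequentially. K * \<rho> ^ n < \<epsilon>"
    using assms by (intro order_tendstoD(2)) auto
  then show ?thesis
    by (auto simp: eventually_sequentially)
qed

text \<open>
  For approximants the corresponding inclusion holds by substitution: if \<open>q e\<close> is a prefix of an
  element of \<open>\<theta>\<^sup>N(c)\<close>, realise its \<open>n\<close>-th image with \<open>v\<close> in the place of \<open>e\<close>. The approximants of level
  \<open>N\<close> and \<open>N + n\<close> converge to the subtiles as \<open>N\<close> grows.
\<close>

lemma subtile_inclusion:
  assumes v: "v \<in> subst_word_iter \<theta> n [e]" "prefix (p @ [b]) v" and x: "x \<in> R e"
  shows "M n x + \<pi> (abelianisation p) \<in> R b"
proof -
  let ?g = "\<lambda>x. M n x + \<pi> (abelianisation p)"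
  have "?g x \<in> closure (S b)" if x: "x \<in> S e" for x
    unfolding closure_approachable
  proof (intro allI impI)
    fix \<epsilon> :: real assume "\<epsilon> > 0"
    then obtain N where N: "(C * E + 3 * E) * \<rho> ^ N < \<epsilon>"
      using rho_power_small by blast
    obtain t where t: "t \<in> approximant N e" "norm (x - t) \<le> E * \<rho> ^ N"
      using S_near_approximant[OF x] by blast
    then obtain q c v' where q: "t = \<pi> (abelianisation q)" "v' \<in> subst_word_iter \<theta> N [c]" "prefix (q @ [e]) v'"
      unfolding approximant_def by blast
    obtain s where s: "v' = q @ [e] @ s"
      using q(3) by (auto simp: prefix_def)
    obtain q' s' where q': "q' \<in> subst_word_iter \<theta> n q" and s': "s' \<in> subst_word_iter \<theta> n s"
      using subst_word_iter_nonempty[OF rs] by blast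
    have "q' @ v @ s' \<in> subst_word_iter \<theta> n v'"
      unfolding s by (intro subst_word_iter_appendI q' v(1) s')
    then have "q' @ v @ s' \<in> subst_word_iter \<theta> (N + n) [c]"
      by (rule subst_word_iter_addI[OF q(2)])
    moreover have "prefix ((q' @ p) @ [b]) (q' @ v @ s')"
      using v(2) by (auto simp: prefix_def)
    ultimately have "\<pi> (abelianisation (q' @ p)) \<in> approximant (N + n) b"
      unfolding approximant_def by blast
    moreover have "\<pi> (abelianisation (q' @ p)) = ?g t"
      using abelianisation_iter[OF q'] by (simp add: q(1) abelianisation_append proj_add proj_M)
    ultimately obtain y where y: "y \<in> S b" "norm (?g t - y) \<le> 3 * E * \<rho> ^ (N + n)"
      using approximant_near_S by metis
    have "\<rho> ^ (N + n) \<le> \<rho> ^ N" "\<rho> ^ n \<le> 1"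
      using rho by (auto intro: power_decreasing power_le_one)
    have "3 * E * \<rho> ^ (N + n) \<le> 3 * E * \<rho> ^ N"
      using E_nonneg \<open>\<rho> ^ (N + n) \<le> \<rho> ^ N\<close> by (intro mult_left_mono) auto
    moreover have "norm (?g x - ?g t) \<le> C * E * \<rho> ^ N"
    proof -
      have "norm (M n (x - t)) \<le> C * \<rho> ^ n * norm (x - t)"
        by (rule decay) (simp add: inner_diff_right S_dot[OF x] q(1))
      also have "\<dots> \<le> C * 1 * (E * \<rho> ^ N)"
        using t(2) \<open>\<rho> ^ n \<le> 1\<close> C_nonneg rho E_nonneg by (intro mult_mono) auto
      finally show ?thesis
        by (simp add: funpow_matrix_vector_diff)
    qed
    then have "norm (?g x - y) \<le> C * E * \<rho> ^ N + 3 * E * \<rho> ^ (N + n)"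
      using y(2) by (rule norm_diff_triangle_le)
    ultimately have "norm (?g x - y) \<le> C * E * \<rho> ^ N + 3 * E * \<rho> ^ N"
      by linarith
    then have "norm (?g x - y) < \<epsilon>"
      using N by (simp add: algebra_simps)
    then show "\<exists>y\<in>S b. dist y (?g x) < \<epsilon>"
      using y(1) by (intro bexI[of _ y]) (auto simp: dist_norm norm_minus_commute)
  qed
  moreover have "continuous_on (closure (S e)) ?g"
    by (intro continuous_intros linear_continuous_on linear_conv_bounded_linear[THEN iffD1] linear_M)
  ultimately have "?g ` closure (S e) \<subseteq> closure (S b)"
    by (intro image_closure_subset) auto
  then show ?thesis
    using x unfolding R_closure by blast
qed

end

section \<open>Interior points\<close>

lemma interior_of_top_of_set:
  "x \<in> top_of_set U interior_of T \<longleftrightarrow> x \<in> U \<and> (\<exists>e>0. ball x e \<inter> U \<subseteq> T)"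
  for U :: "'b::metric_space set"
proof
  assume "x \<in> top_of_set U interior_of T"
  then obtain V where V: "openin (top_of_set U) V" "x \<in> V" "V \<subseteq> T"
    unfolding interior_of_def by blast
  then obtain e where "e > 0" "ball x e \<inter> U \<subseteq> V"
    using openin_contains_ball by metis
  then show "x \<in> U \<and> (\<exists>e>0. ball x e \<inter> U \<subseteq> T)"
    using V openin_imp_subset by blast
next
  assume "x \<in> U \<and> (\<exists>e>0. ball x e \<inter> U \<subseteq> T)"
  then obtain e where e: "x \<in> U" "e > 0" "ball x e \<inter> U \<subseteq> T" by blast
  have "openin (top_of_set U) (ball x e \<inter> U)"
    by (metis openin_open_Int open_ball inf_commute)
  then show "x \<in> top_of_set U interior_of T"
    unfolding interior_of_def using e by auto
qed

context pisot_substitution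
begin

text \<open>
  The coordinate sum of \<open>r\<close> is not \<open>0\<close>, so on the vectors with coordinate sum \<open>0\<close> the projection is
  injective, and a bound for \<open>\<pi> z\<close> bounds \<open>z\<close>.
\<close>

lemma finite_lattice_bounded_proj: "finite {z \<in> zero_sum_lattice. norm (\<pi> z) \<le> B}"
proof (rule finite_subset[OF _ finite_bounded_integral_vectors])
  let ?s = "\<lambda>y::real^'a. \<Sum>i\<in>UNIV. y $ i"
  let ?K = "B + real CARD('a) * B / ?s r * norm r"
  have pos: "?s r > 0"
    using r_pos by (intro sum_pos) auto
  show "{z \<in> zero_sum_lattice. norm (\<pi> z) \<le> B} \<subseteq> {z. \<forall>i. z $ i \<in> \<int> \<and> \<bar>z $ i\<bar> \<le> ?K}"
  proof (intro subsetI CollectI allI conjI)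
    fix z :: "real^'a" and i assume z: "z \<in> {z \<in> zero_sum_lattice. norm (\<pi> z) \<le> B}"
    then show "z $ i \<in> \<int>"
      by (simp add: zero_sum_lattice_def)
    define c where "c = (l \<bullet> z) / (l \<bullet> r)"
    have z_eq: "z = \<pi> z + c *\<^sub>R r"
      by (simp add: proj_along_def c_def)
    have "?s z = ?s (\<pi> z) + c * ?s r"
      by (subst z_eq) (simp add: sum.distrib sum_distrib_left)
    then have "\<bar>c\<bar> * ?s r = \<bar>?s (\<pi> z)\<bar>"
      using z pos by (simp add: zero_sum_lattice_def abs_mult[symmetric] eq_neg_iff_add_eq_0 add.commute)
        (metis abs_minus_cancel abs_mult abs_of_pos eq_neg_iff_add_eq_0)
    also have "\<dots> \<le> (\<Sum>i\<in>UNIV. \<bar>\<pi> z $ i\<bar>)"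
      by (rule sum_abs)
    also have "\<dots> \<le> (\<Sum>i\<in>(UNIV::'a set). B)"
      using z component_le_norm_cart[of "\<pi> z"] by (intro sum_mono) (force intro: order_trans)
    finally have "\<bar>c\<bar> \<le> real CARD('a) * B / ?s r"
      using pos by (simp add: pos_le_divide_eq)
    then have "\<bar>c\<bar> * norm r \<le> real CARD('a) * B / ?s r * norm r"
      by (intro mult_right_mono) auto
    moreover have "norm z \<le> norm (\<pi> z) + \<bar>c\<bar> * norm r"
      using norm_triangle_ineq[of "\<pi> z" "c *\<^sub>R r"] z_eq by simp
    ultimately show "\<bar>z $ i\<bar> \<le> ?K"
      using component_le_norm_cart[of z i] z by auto
  qed
qed

text \<open>
  The inverse of \<open>A\<close> is continuous and preserves the hyperplane.
\<close>

lemma M_preserves_interior: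
  assumes x: "x \<in> top_of_set (hyperplane l) interior_of X" and q: "l \<bullet> q = 0"
    and image: "\<And>y. y \<in> X \<Longrightarrow> M n y + q \<in> Y"
  shows "M n x + q \<in> top_of_set (hyperplane l) interior_of Y"
proof -
  obtain B where B: "A ** B = mat 1" "B ** A = mat 1"
    using det invertible_det_nz[of A] unfolding invertible_def by blast
  define g where "g y = ((*v) B ^^ n) (y - q)" for y
  have left: "((*v) B ^^ n) (M n y) = y" for y
  proof (induction n arbitrary: y)
    case (Suc n)
    have "((*v) B ^^ Suc n) (M (Suc n) y) = ((*v) B ^^ n) (B *v (A *v M n y))"
      by (simp add: funpow_swap1)
    then show ?case
      using Suc by (simp add: matrix_vector_mul_assoc B)
  qed simp
  have right: "M n (((*v) B ^^ n) y) = y" for y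
  proof (induction n arbitrary: y)
    case (Suc n)
    have "M (Suc n) (((*v) B ^^ Suc n) y) = M n (A *v (B *v ((*v) B ^^ n) y))"
      by (simp add: funpow_swap1)
    then show ?case
      using Suc by (simp add: matrix_vector_mul_assoc B)
  qed simp
  have dot_g: "l \<bullet> g y = 0" if "l \<bullet> y = 0" for y
  proof -
    have "l \<bullet> M n (g y) = 0"
      using that q by (simp add: g_def right inner_diff_right)
    then show ?thesis
      using lam by (simp add: dot_M)
  qed
  have "x \<in> hyperplane l"
    using x interior_of_top_of_set by blast
  obtain e where e: "e > 0" "ball x e \<inter> hyperplane l \<subseteq> X"
    using x interior_of_top_of_set by blast
  have "linear (\<lambda>x. ((*v) B ^^ n) x)"
    by (intro linearI) (auto simp: funpow_matrix_vector_add funpow_matrix_vector_scale scalar_mult_eq_scaleR[symmetric])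
  then have "continuous_on UNIV (\<lambda>x. ((*v) B ^^ n) x)"
    by (simp add: linear_continuous_on linear_conv_bounded_linear[symmetric])
  then have "continuous_on UNIV g"
    unfolding g_def by (rule continuous_on_compose2) (auto intro!: continuous_intros)
  then have "\<exists>d>0. \<forall>y. dist y (M n x + q) < d \<longrightarrow> dist (g y) (g (M n x + q)) < e"
    using \<open>e > 0\<close> unfolding continuous_on_iff by auto
  moreover have "g (M n x + q) = x"
    by (simp add: g_def left)
  ultimately obtain d where d: "d > 0" "\<And>y. dist y (M n x + q) < d \<Longrightarrow> dist (g y) x < e"
    by auto
  have "ball (M n x + q) d \<inter> hyperplane l \<subseteq> Y"
  proof
    fix y assume y: "y \<in> ball (M n x + q) d \<inter> hyperplane l"
    then have "g y \<in> X"
      using d(2)[of y] e(2) dot_g[of y] by (auto simp: hyperplane_def dist_commute)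
    then have "M n (g y) + q \<in> Y"
      by (rule image)
    then show "y \<in> Y"
      by (simp add: g_def right)
  qed
  moreover have "M n x + q \<in> hyperplane l"
    using \<open>x \<in> hyperplane l\<close> q by (simp add: hyperplane_def inner_add_right dot_M)
  ultimately show ?thesis
    using d(1) interior_of_top_of_set by blast
qed

end

context rauzy_fractal
begin

text \<open>
  Let \<open>z\<close> be an integer vector with coordinate sum \<open>m \<ge> 0\<close> whose projection is close to \<open>x\<close>. The prefix of
  \<open>w\<close> of length \<open>m\<close> has the same coordinate sum, so subtracting its abelianisation from \<open>z\<close> leaves an
  element of the lattice. Only finitely many lattice vectors arise in this way, as their projections
  are bounded; so \<open>x\<close> lies in a finite union of closed translates.
\<close>

lemma translates_cover:
  assumes "x \<in> hyperplane l"
  shows "\<exists>b. \<exists>z\<in>zero_sum_lattice. x \<in> (+) (\<pi> z) ` R b"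
proof -
  define Z where "Z = {z \<in> zero_sum_lattice. norm (\<pi> z) \<le> norm x + 1 + E}"
  have "finite Z"
    unfolding Z_def by (rule finite_lattice_bounded_proj)
  let ?U = "\<Union>(z, b)\<in>Z \<times> UNIV. (+) (\<pi> z) ` S b"
  have "x \<in> closure ?U"
    unfolding closure_approachable
  proof (intro allI impI)
    fix \<epsilon> :: real assume "\<epsilon> > 0"
    obtain K where K: "K > 0" "\<And>y. norm (\<pi> y) \<le> norm y * K"
      using bounded_linear.pos_bounded[of \<pi>] linear_proj linear_conv_bounded_linear by blast
    have "min \<epsilon> 1 / K > 0"
      using \<open>\<epsilon> > 0\<close> K by simp
    then obtain z t where z: "\<forall>i. z $ i \<in> \<int>" "(\<Sum>i\<in>UNIV. z $ i) \<ge> 0" "norm (z - t *\<^sub>R r - x) < min \<epsilon> 1 / K"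
      using simultaneous_approximation_nonneg[of r "min \<epsilon> 1 / K" x] indep r_pos by blast
    have "\<pi> (z - t *\<^sub>R r - x) = \<pi> z - x"
      using assms by (simp add: proj_diff proj_scaleR proj_id hyperplane_def)
    then have "norm (\<pi> z - x) \<le> norm (z - t *\<^sub>R r - x) * K"
      using K(2) by metis
    also have "\<dots> < min \<epsilon> 1"
      using z(3) K(1) by (simp add: pos_less_divide_eq)
    finally have near: "norm (\<pi> z - x) < \<epsilon>" "norm (\<pi> z - x) < 1"
      by auto
    have "(\<Sum>i\<in>UNIV. z $ i) \<in> \<int>"
      using z(1) by (intro Ints_sum) auto
    then obtain m :: nat where m: "(\<Sum>i\<in>UNIV. z $ i) = real m"
      using z(2) by (metis Ints_cases of_int_0_le_iff nonneg_int_cases of_int_of_nat_eq)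
    let ?p = "abelianisation (factor w 0 m)"
    have in_S: "\<pi> ?p \<in> S (w m)"
      by (rule S_I) simp
    have "norm (\<pi> ?p) \<le> E"
      using S_contraction[OF in_S, of 0] by simp
    moreover have "\<pi> (z - ?p) = (\<pi> z - x) + x - \<pi> ?p"
      by (simp add: proj_diff)
    then have "norm (\<pi> (z - ?p)) \<le> norm (\<pi> z - x) + norm x + norm (\<pi> ?p)"
      using norm_triangle_ineq4[of "(\<pi> z - x) + x" "\<pi> ?p"] norm_triangle_ineq[of "\<pi> z - x" x] by simp
    ultimately have "norm (\<pi> (z - ?p)) \<le> norm x + 1 + E"
      using near(2) by linarith
    moreover have "z - ?p \<in> zero_sum_lattice"
      using z(1) by (simp add: zero_sum_lattice_def sum_subtractf m sum_abelianisation abelianisation_integral)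
    ultimately have "z - ?p \<in> Z"
      by (simp add: Z_def)
    moreover have "\<pi> z = \<pi> (z - ?p) + \<pi> ?p"
      by (simp add: proj_diff)
    ultimately have "\<pi> z \<in> ?U"
      using in_S by blast
    then show "\<exists>y\<in>?U. dist y x < \<epsilon>"
      using near(1) unfolding dist_norm by blast
  qed
  also have "closure ?U \<subseteq> (\<Union>(z, b)\<in>Z \<times> UNIV. (+) (\<pi> z) ` R b)"
  proof (rule closure_minimal)
    show "?U \<subseteq> (\<Union>(z, b)\<in>Z \<times> UNIV. (+) (\<pi> z) ` R b)"
      using closure_subset unfolding R_closure by fastforce
    show "closed (\<Union>(z, b)\<in>Z \<times> UNIV. (+) (\<pi> z) ` R b)"
      using \<open>finite Z\<close> by (intro closed_UN) (auto simp: R_closure intro: closed_translation)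
  qed
  finally show ?thesis
    by (auto simp: Z_def)
qed

lemma R_hyperplane: "R b \<subseteq> hyperplane l"
proof -
  have "closed (hyperplane l)"
    unfolding hyperplane_def by (rule closed_hyperplane)
  moreover have "S b \<subseteq> hyperplane l"
    using S_dot by (auto simp: hyperplane_def)
  ultimately show ?thesis
    unfolding R_closure by (rule closure_minimal[rotated])
qed

lemma some_subtile_has_interior: "\<exists>b. top_of_set (hyperplane l) interior_of R b \<noteq> {}"
proof -
  let ?X = "top_of_set (hyperplane l)"
  \<comment> \<open>countably many closed sets that cover the hyperplane, which is completely metrizable\<close>
  let ?G = "(\<lambda>(z, b). (+) (\<pi> z) ` R b) ` (zero_sum_lattice \<times> UNIV)"
  have closed_H: "closed (hyperplane l)"
    unfolding hyperplane_def by (rule closed_hyperplane)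
  have "\<exists>z b. ?X interior_of ((+) (\<pi> z) ` R b) \<noteq> {}"
  proof (rule ccontr)
    assume empty: "\<not> ?thesis"
    have "?X interior_of \<Union>?G = {}"
    proof (rule Baire_category_alt)
      show "completely_metrizable_space ?X \<or> locally_compact_space ?X \<and> regular_space ?X"
        using completely_metrizable_space_closedin[OF completely_metrizable_space_euclidean
            closed_H[unfolded closed_closedin]] by (rule disjI1)
      show "countable ?G"
        by (intro countable_image countable_SIGMA countable_zero_sum_lattice) (simp add: countable_finite)
      fix T assume "T \<in> ?G"
      then obtain z b where T: "T = (+) (\<pi> z) ` R b"
        by auto
      have "closed T"
        unfolding T R_closure by (intro closed_translation closed_closure)
      moreover have "T \<subseteq> hyperplane l"
        using R_hyperplane[of b] unfolding T by (auto simp: hyperplane_def inner_add_right)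
      ultimately show "closedin ?X T \<and> ?X interior_of T = {}"
        using empty T by (auto intro: closed_subset)
    qed
    moreover have "hyperplane l \<subseteq> \<Union>?G"
      using translates_cover by fastforce
    moreover have "0 \<in> hyperplane l"
      by (simp add: hyperplane_def)
    ultimately show False
      using interior_of_top_of_set[of 0 "hyperplane l" "\<Union>?G"] zero_less_one by blast
  qed
  then obtain z b y where y: "y \<in> ?X interior_of ((+) (\<pi> z) ` R b)"
    by blast
  \<comment> \<open>undo the translation by \<open>\<pi> z\<close>\<close>
  have "M 0 y + (- \<pi> z) \<in> ?X interior_of R b"
    by (rule M_preserves_interior[OF y]) auto
  then show ?thesis by blast
qed

lemma interior_inclusion:
  assumes "v \<in> subst_word_iter \<theta> n [e]" "prefix (p @ [b]) v"
    and "x \<in> top_of_set (hyperplane l) interior_of R e"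
  shows "M n x + \<pi> (abelianisation p) \<in> top_of_set (hyperplane l) interior_of R b"
  using assms(3) by (rule M_preserves_interior) (use subtile_inclusion[OF assms(1,2)] in auto)

text \<open>
  By primitivity the letter \<open>b\<close> occurs in the \<open>k0\<close>-th image of the letter \<open>e\<close> whose subtile has
  interior points, so \<open>R b\<close> contains an affine copy of that subtile.
\<close>

lemma subtile_has_interior: "\<exists>x. x \<in> top_of_set (hyperplane l) interior_of R b"
proof -
  obtain e x where x: "x \<in> top_of_set (hyperplane l) interior_of R e"
    using some_subtile_has_interior by blast
  obtain v where v: "v \<in> subst_word_iter \<theta> k0 [e]"
    using subst_word_iter_nonempty[OF rs] by blast
  obtain p s where "v = p @ b # s"
    using mixing[OF v, of b] by (auto simp: in_set_conv_decomp)
  then show ?thesis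
    using interior_inclusion[OF v _ x, of p b] by auto
qed

lemma R_contraction: "x \<in> R b \<Longrightarrow> norm (M n x) \<le> E * \<rho> ^ n"
proof -
  assume "x \<in> R b"
  have "continuous_on UNIV (\<lambda>x. norm (M n x))"
    by (intro continuous_intros linear_continuous_on linear_conv_bounded_linear[THEN iffD1] linear_M)
  then have "closed {x. norm (M n x) \<le> E * \<rho> ^ n}"
    by (rule closed_Collect_le[OF _ continuous_on_const])
  then have "closure (S b) \<subseteq> {x. norm (M n x) \<le> E * \<rho> ^ n}"
    by (intro closure_minimal) (auto intro: S_contraction)
  then show ?thesis
    using \<open>x \<in> R b\<close> R_closure by auto
qed

theorem rauzy_fractal_closure_interior:
  "(\<Union>b. R b) \<subseteq> hyperplane l \<and>
   (\<Union>b. R b) = top_of_set (hyperplane l) closure_of (top_of_set (hyperplane l) interior_of (\<Union>b. R b))"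
proof
  let ?H = "top_of_set (hyperplane l)"
  let ?F = "\<Union>b. R b"
  show "?F \<subseteq> hyperplane l"
    using R_hyperplane by blast
  have closed: "closed ?F"
    unfolding R_closure by (intro closed_UN) auto
  have closure_of: "?H closure_of (?H interior_of ?F) = hyperplane l \<inter> closure (?H interior_of ?F)"
    using interior_of_subset_topspace[of ?H ?F]
    by (simp add: closure_of_subtopology inf_absorb2 Int_absorb1)
  have "S b \<subseteq> closure (?H interior_of ?F)" for b
  proof
    fix x assume x: "x \<in> S b"
    show "x \<in> closure (?H interior_of ?F)"
      unfolding closure_approachable
    proof (intro allI impI)
      fix \<epsilon> :: real assume "\<epsilon> > 0"
      then obtain n where n: "(2 * E) * \<rho> ^ n < \<epsilon>"
        using rho_power_small by blast
      obtain t where t: "t \<in> approximant n b" "norm (x - t) \<le> E * \<rho> ^ n"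
        using S_near_approximant[OF x] by blast
      obtain p c v where p: "t = \<pi> (abelianisation p)" "v \<in> subst_word_iter \<theta> n [c]" "prefix (p @ [b]) v"
        using t(1) unfolding approximant_def by blast
      obtain y where y: "y \<in> ?H interior_of R c"
        using subtile_has_interior by blast
      then have "y \<in> R c"
        by (rule subsetD[OF interior_of_subset])
      have "M n y + t \<in> ?H interior_of R b"
        unfolding p(1) by (rule interior_inclusion[OF p(2,3) y])
      moreover have "?H interior_of R b \<subseteq> ?H interior_of ?F"
        by (intro interior_of_mono) blast
      moreover have "norm (M n y + t - x) \<le> norm (M n y) + norm (x - t)"
        using norm_triangle_ineq4[of "M n y" "x - t"] by (simp add: algebra_simps)
      then have "dist (M n y + t) x < \<epsilon>"
        using R_contraction[OF \<open>y \<in> R c\<close>, of n] t(2) n by (simp add: dist_norm)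
      ultimately show "\<exists>y\<in>?H interior_of ?F. dist y x < \<epsilon>"
        by blast
    qed
  qed
  then have "R b \<subseteq> closure (?H interior_of ?F)" for b
    unfolding R_closure by (intro closure_minimal) auto
  then have "?F \<subseteq> ?H closure_of (?H interior_of ?F)"
    unfolding closure_of using R_hyperplane by blast
  moreover have "closure (?H interior_of ?F) \<subseteq> ?F"
    using closed interior_of_subset[of ?H ?F] by (rule closure_minimal[rotated])
  ultimately show "?F = ?H closure_of (?H interior_of ?F)"
    unfolding closure_of by blast
qed

end

section \<open>Irreducible Pisot random substitutions\<close>

lemma real_subst_matrix_column:
  assumes "compatible \<theta>" "v \<in> \<theta> a"
  shows "abelianisation v = real_subst_matrix \<theta> *v axis a 1"
proof -
  have "(SOME v. v \<in> \<theta> a) \<in> \<theta> a"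
    using assms(2) by (rule someI)
  then have "abelianisation v = abelianisation (SOME v. v \<in> \<theta> a)"
    using assms unfolding compatible_def by blast
  then show ?thesis
    by (simp add: abelianisation_def real_subst_matrix_def subst_matrix_def map_matrix_def
        matrix_vector_mult_def vec_eq_iff axis_def if_distrib cong: if_cong)
qed

theorem corollary4p5:
  fixes \<theta> :: "'a::finite \<Rightarrow> 'a list set"
    and l r :: "real ^ 'a"
    and F :: "(real ^ 'a) set"
  assumes "random_substitution \<theta>"
    and "compatible \<theta>"
    and "unimodular \<theta>"
    and "irreducible_pisot \<theta>"
    and "left_pf_eigenvector (real_subst_matrix \<theta>) l"
    and "right_pf_eigenvector (real_subst_matrix \<theta>) r"
    and "is_rauzy_fractal \<theta> l r F"
  shows "F \<subseteq> hyperplane l \<and>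
    F = top_of_set (hyperplane l) closure_of (top_of_set (hyperplane l) interior_of F)"
proof -
  let ?A = "real_subst_matrix \<theta>"
  let ?N = "subst_matrix \<theta>"
  obtain lam where lam: "pf_eigenvalue ?A lam" "pisot_number lam"
    using assms(4) unfolding irreducible_pisot_def by blast
  have "lam > 1"
    using lam(2) unfolding pisot_number_def by blast
  have eigen: "eigenvalue ?A lam"
    using lam(1) unfolding pf_eigenvalue_def by blast
  have l: "\<forall>i. l $ i > 0" "l v* ?A = lam *s l"
    using assms(5) pf_eigenvalue_unique[OF lam(1)] unfolding left_pf_eigenvector_def by auto
  have r: "\<forall>i. r $ i > 0" "?A *v r = lam *s r"
    using assms(6) pf_eigenvalue_unique[OF lam(1)] unfolding right_pf_eigenvector_def by auto
  obtain k where k: "\<forall>i j. (((**) ?A) ^^ k) (mat 1) $ i $ j > 0"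
    using assms(4) unfolding irreducible_pisot_def primitive_subst_def primitive_matrix_def by blast
  have irred: "irreducible (charpoly ?N)"
    using assms(4) unfolding irreducible_pisot_def by blast
  have small: "cmod c < 1" if "poly (map_poly of_int (charpoly ?N)) c = 0" "c \<noteq> complex_of_real lam" for c
    using irred lam(2) eigen[unfolded real_subst_matrix_def] that by (rule pisot_conjugates_small)
  have det: "det ?A \<noteq> 0"
  proof -
    have "det ?A = real_of_int (det ?N)"
      unfolding real_subst_matrix_def by (subst ring_hom_det[where f=real_of_int]) auto
    then show ?thesis
      using assms(3) unfolding unimodular_def by auto
  qed
  obtain C \<rho> where decay: "0 < \<rho>" "\<rho> < 1" "0 \<le> C"
    "\<And>x n. l \<bullet> x = 0 \<Longrightarrow> norm (((*v) ?A ^^ n) x) \<le> C * \<rho> ^ n * norm x"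
  proof -
    have "cmod c < 1" if "eigenvalue (map_matrix complex_of_real ?A) c" "c \<noteq> complex_of_real lam" for c
      using that small eigenvalue_root_charpoly[of ?N c]
      by (simp add: real_subst_matrix_def map_matrix_of_int_complex)
    then show ?thesis
      using hyperplane_decay[OF l r k] that by blast
  qed
  have indep: "c = 0" if "\<And>i. c $ i \<in> \<int>" "r \<bullet> c = 0" for c
  proof -
    \<comment> \<open>the transpose exchanges the roles of \<open>l\<close> and \<open>r\<close>, so it contracts the hyperplane orthogonal to \<open>r\<close>\<close>
    let ?T = "transpose ?A"
    have T: "?T = map_matrix real_of_int (transpose ?N)"
      by (simp add: real_subst_matrix_def transpose_def map_matrix_def vec_eq_iff)
    have "cmod c < 1" if "eigenvalue (map_matrix complex_of_real ?T) c" "c \<noteq> complex_of_real lam" for c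
      using that small eigenvalue_root_charpoly[of "transpose ?N" c]
      by (simp add: T map_matrix_of_int_complex charpoly_transpose)
    moreover have "\<forall>i j. (((**) ?T) ^^ k) (mat 1) $ i $ j > 0"
      unfolding transpose_matrix_power using k by (simp add: transpose_def)
    moreover have "r v* ?T = lam *s r" "?T *v l = lam *s l"
      using l r by simp_all
    ultimately obtain K \<sigma> where "0 < \<sigma>" "\<sigma> < 1"
      "\<And>x n. r \<bullet> x = 0 \<Longrightarrow> norm (((*v) ?T ^^ n) x) \<le> K * \<sigma> ^ n * norm x"
      using hyperplane_decay[of r ?T lam l k] l(1) r(1) by blast
    moreover have "?T $ i $ j \<in> \<int>" for i j
      by (simp add: T map_matrix_def)
    ultimately show ?thesis
      using integer_vector_orthogonal_zero[of ?T \<sigma> r K c] det that by simp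
  qed
  have abel: "abelianisation v = ?A *v axis a 1" if "v \<in> \<theta> a" for v a
    using assms(2) that by (rule real_subst_matrix_column)
  have iter: "abelianisation v = ((*v) ?A ^^ n) (axis a 1)" if "v \<in> subst_word_iter \<theta> n [a]" for v n a
    using abelianisation_subst_word_iter[of \<theta> ?A v n "[a]"] abel that by (simp add: abelianisation_singleton)
  have mixing: "b \<in> set v" if "v \<in> subst_word_iter \<theta> k [a]" for a b v
  proof -
    have "abelianisation v $ b = (((**) ?A) ^^ k) (mat 1) $ b $ a"
      unfolding iter[OF that] matrix_power_apply[symmetric]
      by (simp add: matrix_vector_mult_def axis_def if_distrib cong: if_cong)
    then have "abelianisation v $ b > 0"
      using k by metis
    then have "count_list v b \<noteq> 0"
      by (simp add: abelianisation_def)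
    then show ?thesis
      using count_list_0_iff by metis
  qed
  have growth: "\<exists>n a v. v \<in> subst_word_iter \<theta> n [a] \<and> L \<le> length v" for L
  proof -
    fix a :: 'a
    define K where "K = (\<Sum>i\<in>UNIV. l $ i)"
    have K: "l $ i \<le> K" for i
      unfolding K_def using l(1) by (intro member_le_sum) (auto intro: less_imp_le)
    have "K > 0"
      using K[of undefined] l(1) by (metis less_le_trans)
    obtain n where n: "real L * K / l $ a < lam ^ n"
      using real_arch_pow[OF \<open>lam > 1\<close>] by blast
    obtain v where v: "v \<in> subst_word_iter \<theta> n [a]"
      using subst_word_iter_nonempty[OF assms(1)] by blast
    have "l \<bullet> ((*v) ?A ^^ n) x = lam ^ n * (l \<bullet> x)" for x
      by (induction n) (auto simp: dot_matrix_vector l(2) scalar_mult_eq_scaleR)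
    then have "lam ^ n * l $ a = l \<bullet> abelianisation v"
      by (simp add: iter[OF v] inner_axis)
    also have "\<dots> \<le> (\<Sum>i\<in>UNIV. K * abelianisation v $ i)"
      unfolding inner_vec_def using K by (intro sum_mono) (simp add: mult_right_mono abelianisation_def)
    also have "\<dots> = K * real (length v)"
      by (simp add: sum_distrib_left[symmetric] sum_abelianisation)
    finally have "real L * K < K * real (length v)"
      using n l(1) by (simp add: pos_divide_less_eq)
    then have "L \<le> length v"
      using \<open>K > 0\<close> by (simp add: mult.commute)
    then show ?thesis
      using v by blast
  qed
  interpret pisot_substitution \<theta> k ?A l r lam C \<rho>
    by unfold_locales (fact assms(1) mixing growth abel l r \<open>lam > 1\<close> det decay indep)+
  obtain E where E: "E \<ge> 0" "\<And>u n. legal \<theta> u \<Longrightarrow> norm (M n (\<pi> (abelianisation u))) \<le> E * \<rho> ^ n"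
    using legal_contraction by blast
  obtain w where w: "w \<in> subst_space_infinity \<theta>" "has_dense_orbit \<theta> w" "F = (\<Union>a. rauzy_subtile l r w a)"
    using assms(7) unfolding is_rauzy_fractal_def by blast
  interpret rauzy_fractal \<theta> k ?A l r lam C \<rho> w E
    by unfold_locales (fact w E)+
  show ?thesis
    unfolding w(3) by (rule rauzy_fractal_closure_interior)
qed

end
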